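(* Let $k$ be an algebraically closed field, let $P\in\mathbb{P}^2$ and let $C\subset\mathbb{P}^2$ be an irreducible curve. If the extension $k(C)/K_P$ is Galois of degree at most $3$, then $G_P$ extends to a subgroup of $\mathrm{Jonq}_P\subseteq\mathrm{Bir}(\mathbb{P}^2)$.
   Context: Let $\pi_P:\mathbb{P}^2\dashrightarrow\mathbb{P}^1$ be the projection from the point $P$, and consider its restriction $\pi_P|_C:C\dashrightarrow\mathbb{P}^1$. Put $K_P=\pi_P^*(k(\mathbb{P}^1))\subseteq k(C)$. The point $P$ is called Galois (for $C$) if $k(C)/K_P$ is a Galois extension, and then $G_P=\mathrm{Gal}(k(C)/K_P)$. Elements of $G_P$ are identified with birational maps $g:C\dashrightarrow C$ satisfying $\pi_P|_C\circ g=\pi_P|_C$. $\mathrm{Bir}(\mathbb{P}^2)$ is the group of birational self-maps of $\mathbb{P}^2$. The Jonquières group of $P$ is $\mathrm{Jonq}_P=\{\varphi\in\mathrm{Bir}(\mathbb{P}^2)\mid \exists\,\alpha\in\mathrm{Aut}(\mathbb{P}^1):\ \pi_P\circ\varphi=\alpha\circ\pi_P\}$. An element $\varphi\in\mathrm{Bir}(\mathbb{P}^2)$ preserves $C$ if it restricts to a birational transformation of $C$. An element $g\in G_P$ extends to $\varphi$ if $\varphi$ preserves $C$ and $\varphi|_C=g$. The group $G_P$ extends to a subgroup of a group $\Gamma\subseteq\mathrm{Bir}(\mathbb{P}^2)$ if there is a subgroup $H\subseteq\Gamma$ all of whose elements preserve $C$ and such that restriction to $C$ induces an isomorphism $H\to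 G_P$. *)

theory Defs
  imports
    "HOL-Algebra.Finite_Extensions"
    "HOL-Algebra.Bij"
    "HOL-Computational_Algebra.Polynomial"
    "HOL-Library.Poly_Mapping"
    "HOL-Library.Numeral_Type"
begin

section \<open>Polynomials in finitely many variables\<close>

text \<open>The polynomial ring over \<open>'k\<close> in variables indexed by \<open>'n\<close> is the monoid algebra of
  \<open>'n \<Rightarrow>\<^sub>0 nat\<close>; its ring structure is the convolution product of \<open>Poly_Mapping\<close>.\<close>

type_synonym ('n, 'k) mpoly = "('n \<Rightarrow>\<^sub>0 nat) \<Rightarrow>\<^sub>0 'k"

definition const :: "'k \<Rightarrow> ('n, 'k::zero) mpoly"
  where "const c = Poly_Mapping.single 0 c"

definition coord :: "'n \<Rightarrow> ('n, 'k::zero_neq_one) mpoly"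
  where "coord i = Poly_Mapping.single (Poly_Mapping.single i 1) 1"

definition evaluate ::
    "('k \<Rightarrow> 'r) \<Rightarrow> ('n \<Rightarrow> 'r) \<Rightarrow> ('n::finite, 'k::zero) mpoly \<Rightarrow> 'r::comm_semiring_1"
  where "evaluate h v P =
    (\<Sum>m\<in>Poly_Mapping.keys P. h (Poly_Mapping.lookup P m) * (\<Prod>i\<in>UNIV. v i ^ Poly_Mapping.lookup m i))"

abbreviation value_at :: "('n \<Rightarrow> 'k) \<Rightarrow> ('n::finite, 'k::field) mpoly \<Rightarrow> 'k"
  where "value_at \<equiv> evaluate (\<lambda>c. c)"

abbreviation subst :: "('n \<Rightarrow> ('m, 'k) mpoly) \<Rightarrow> ('n::finite, 'k::field) mpoly \<Rightarrow> ('m, 'k) mpoly"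
  where "subst \<equiv> evaluate const"

definition homogeneous :: "nat \<Rightarrow> ('n::finite, 'k::zero) mpoly \<Rightarrow> bool"
  where "homogeneous d P \<longleftrightarrow>
    (\<forall>m\<in>Poly_Mapping.keys P. (\<Sum>i\<in>UNIV. Poly_Mapping.lookup m i) = d)"


section \<open>Rational maps\<close>

text \<open>Throughout, \<open>F\<close> is either an irreducible form, standing for the hypersurface \<open>F = 0\<close>, or
  \<open>0\<close>, standing for the whole projective space: its homogeneous coordinate ring is the polynomial
  ring modulo \<open>F\<close>, and \<open>F dvd A\<close> says that the form \<open>A\<close> vanishes on it. For \<open>F = 0\<close>,
  \<open>F dvd A\<close> is \<open>A = 0\<close>.\<close>

definition irreducible_curve :: "(3, 'k::field) mpoly \<Rightarrow> bool"
  where "irreducible_curve F \<longleftrightarrow> (\<exists>d. homogeneous d F) \<and> Factorial_Ring.irreducible F"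

text \<open>\<open>\<Phi>\<close> represents a rational map \<open>[\<Phi> 0 : \<Phi> 1 : \<dots>]\<close> from the hypersurface \<open>F\<close> to the
  projective space with coordinates indexed by \<open>'m\<close>.\<close>

definition rational_map :: "('n::finite, 'k::field) mpoly \<Rightarrow> ('m \<Rightarrow> ('n, 'k) mpoly) \<Rightarrow> bool"
  where "rational_map F \<Phi> \<longleftrightarrow> (\<exists>d. \<forall>i. homogeneous d (\<Phi> i)) \<and> (\<exists>i. \<not> F dvd \<Phi> i)"

definition same_map ::
    "('n::finite, 'k::field) mpoly \<Rightarrow> ('m \<Rightarrow> ('n, 'k) mpoly) \<Rightarrow> ('m \<Rightarrow> ('n, 'k) mpoly) \<Rightarrow> bool"
  where "same_map F \<Phi> \<Psi> \<longleftrightarrow> rational_map F \<Phi> \<and> rational_map F \<Psi> \<and>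
    (\<forall>i j. F dvd \<Phi> i * \<Psi> j - \<Phi> j * \<Psi> i)"

definition map_class ::
    "('n::finite, 'k::field) mpoly \<Rightarrow> ('m \<Rightarrow> ('n, 'k) mpoly) \<Rightarrow> ('m \<Rightarrow> ('n, 'k) mpoly) set"
  where "map_class F \<Phi> = {\<Psi>. same_map F \<Phi> \<Psi>}"

definition comp_map ::
    "('m \<Rightarrow> ('n::finite, 'k::field) mpoly) \<Rightarrow> ('n \<Rightarrow> ('l, 'k) mpoly) \<Rightarrow> 'm \<Rightarrow> ('l, 'k) mpoly"
  where "comp_map \<Phi> \<Psi> = (\<lambda>i. subst \<Psi> (\<Phi> i))"

definition self_map :: "('n::finite, 'k::field) mpoly \<Rightarrow> ('n \<Rightarrow> ('n, 'k) mpoly) \<Rightarrow> bool"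
  where "self_map F \<Phi> \<longleftrightarrow> rational_map F \<Phi> \<and> F dvd subst \<Phi> F"

definition birational :: "('n::finite, 'k::field) mpoly \<Rightarrow> ('n \<Rightarrow> ('n, 'k) mpoly) \<Rightarrow> bool"
  where "birational F \<Phi> \<longleftrightarrow> self_map F \<Phi> \<and>
    (\<exists>\<Psi>. self_map F \<Psi> \<and>
      same_map F (comp_map \<Phi> \<Psi>) coord \<and> same_map F (comp_map \<Psi> \<Phi>) coord)"

text \<open>The group of birational self-maps. The unions range over all representatives; they are
  unions of copies of one and the same class.\<close>

definition Bir :: "('n::finite, 'k::field) mpoly \<Rightarrow> ('n \<Rightarrow> ('n, 'k) mpoly) set monoid"
  where "Bir F =
    \<lparr>carrier = {map_class F \<Phi> | \<Phi>. birational F \<Phi>},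
     mult = \<lambda>\<phi> \<psi>. \<Union>\<Phi>\<in>\<phi>. \<Union>\<Psi>\<in>\<psi>. map_class F (comp_map \<Phi> \<Psi>),
     one = map_class F coord\<rparr>"

abbreviation Bir_P2 :: "(3 \<Rightarrow> (3, 'k::field) mpoly) set monoid"
  where "Bir_P2 \<equiv> Bir 0"

text \<open>Restriction to the curve \<open>F\<close> of a rational self-map of the plane. Representatives all of
  whose components vanish on \<open>F\<close> contribute nothing, because \<open>map_class F \<Phi>\<close> is then empty.\<close>

definition restrict_to ::
    "(3, 'k::field) mpoly \<Rightarrow> (3 \<Rightarrow> (3, 'k) mpoly) set \<Rightarrow> (3 \<Rightarrow> (3, 'k) mpoly) set"
  where "restrict_to F \<phi> = (\<Union>\<Phi>\<in>\<phi>. map_class F \<Phi>)"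

definition preserves :: "(3, 'k::field) mpoly \<Rightarrow> (3 \<Rightarrow> (3, 'k) mpoly) set \<Rightarrow> bool"
  where "preserves F \<phi> \<longleftrightarrow> restrict_to F \<phi> \<in> carrier (Bir F)"


section \<open>Projection from a point and the Jonquieres group\<close>

text \<open>A projection from the point with homogeneous coordinates \<open>p\<close>: a basis \<open>l 0, l 1\<close> of the
  linear forms vanishing at \<open>p\<close>. Two choices differ by an automorphism of the projective line.\<close>

definition projection_from :: "(3 \<Rightarrow> 'k::field) \<Rightarrow> (2 \<Rightarrow> (3, 'k) mpoly) \<Rightarrow> bool"
  where "projection_from p l \<longleftrightarrow>
    (\<forall>i. homogeneous 1 (l i) \<and> value_at p (l i) = 0) \<and>
    (\<forall>a b. const a * l 0 + const b * l 1 = 0 \<longrightarrow> a = 0 \<and> b = 0)"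

definition morphism :: "('m \<Rightarrow> ('n::finite, 'k::field) mpoly) \<Rightarrow> bool"
  where "morphism \<alpha> \<longleftrightarrow> (\<exists>d. \<forall>i. homogeneous d (\<alpha> i)) \<and>
    (\<forall>v. (\<exists>j. v j \<noteq> 0) \<longrightarrow> (\<exists>i. value_at v (\<alpha> i) \<noteq> 0))"

definition automorphism :: "('n \<Rightarrow> ('n::finite, 'k::field) mpoly) \<Rightarrow> bool"
  where "automorphism \<alpha> \<longleftrightarrow> morphism \<alpha> \<and>
    (\<exists>\<beta>. morphism \<beta> \<and> same_map 0 (comp_map \<alpha> \<beta>) coord \<and> same_map 0 (comp_map \<beta> \<alpha>) coord)"

definition Jonq :: "(2 \<Rightarrow> (3, 'k::field) mpoly) \<Rightarrow> (3 \<Rightarrow> (3, 'k) mpoly) set set"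
  where "Jonq l = {\<phi> \<in> carrier Bir_P2.
    \<exists>\<alpha>. automorphism \<alpha> \<and> (\<forall>\<Phi>\<in>\<phi>. same_map 0 (comp_map l \<Phi>) (comp_map \<alpha> l))}"


section \<open>Function fields\<close>

definition fractions :: "('n::finite, 'k::field) mpoly \<Rightarrow> (('n, 'k) mpoly \<times> ('n, 'k) mpoly) set"
  where "fractions F = {(A, B). (\<exists>d. homogeneous d A \<and> homogeneous d B) \<and> \<not> F dvd B}"

definition frac_class ::
    "('n::finite, 'k::field) mpoly \<Rightarrow> ('n, 'k) mpoly \<times> ('n, 'k) mpoly
      \<Rightarrow> (('n, 'k) mpoly \<times> ('n, 'k) mpoly) set"
  where "frac_class F = (\<lambda>(A, B). {(A', B').
    (A, B) \<in> fractions F \<and> (A', B') \<in> fractions F \<and> F dvd A * B' - A' * B})"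

definition function_field ::
    "('n::finite, 'k::field) mpoly \<Rightarrow> (('n, 'k) mpoly \<times> ('n, 'k) mpoly) set ring"
  where "function_field F =
    \<lparr>carrier = frac_class F ` fractions F,
     mult = \<lambda>x y. \<Union>(A, B)\<in>x. \<Union>(C, D)\<in>y. frac_class F (A * C, B * D),
     one = frac_class F (1, 1),
     zero = frac_class F (0, 1),
     add = \<lambda>x y. \<Union>(A, B)\<in>x. \<Union>(C, D)\<in>y. frac_class F (A * D + C * B, B * D)\<rparr>"

text \<open>The subfield \<open>K\<^sub>P\<close>: rational functions on the projective line pulled back along the
  restriction of the projection \<open>l\<close>. If that restriction is constant, i.e. the curve is a line
  through \<open>p\<close>, the functions defined at its value pull back to the constants.\<close>

definition pencil_field ::
    "(3, 'k::field) mpoly \<Rightarrow> (2 \<Rightarrow> (3, 'k) mpoly) \<Rightarrow> ((3, 'k) mpoly \<times> (3, 'k) mpoly) set set"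
  where "pencil_field F l = {frac_class F (subst l a, subst l b) | a b d.
    homogeneous d a \<and> homogeneous d b \<and> \<not> F dvd subst l b}"

definition pullback ::
    "('n::finite, 'k::field) mpoly \<Rightarrow> ('n \<Rightarrow> ('n, 'k) mpoly) set
      \<Rightarrow> (('n, 'k) mpoly \<times> ('n, 'k) mpoly) set \<Rightarrow> (('n, 'k) mpoly \<times> ('n, 'k) mpoly) set"
  where "pullback F g = (\<lambda>f\<in>carrier (function_field F).
    \<Union>\<Phi>\<in>g. \<Union>(A, B)\<in>f. frac_class F (subst \<Phi> A, subst \<Phi> B))"

text \<open>The identification of birational self-maps of the curve with automorphisms of its function
  field. Pullback reverses composition, so \<open>g\<close> corresponds to \<open>f \<mapsto> f \<circ> g\<^sup>-\<^sup>1\<close>.\<close>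

definition field_aut ::
    "('n::finite, 'k::field) mpoly \<Rightarrow> ('n \<Rightarrow> ('n, 'k) mpoly) set
      \<Rightarrow> (('n, 'k) mpoly \<times> ('n, 'k) mpoly) set \<Rightarrow> (('n, 'k) mpoly \<times> ('n, 'k) mpoly) set"
  where "field_aut F g = pullback F (inv\<^bsub>Bir F\<^esub> g)"


section \<open>Galois extensions\<close>

definition Gal :: "('a, 'b) ring_scheme \<Rightarrow> 'a set \<Rightarrow> ('a \<Rightarrow> 'a) monoid"
  where "Gal L K = BijGroup (carrier L)
    \<lparr>carrier := {\<sigma> \<in> Bij (carrier L). \<sigma> \<in> ring_hom L L \<and> (\<forall>x\<in>K. \<sigma> x = x)}\<rparr>"

definition galois_extension :: "('a, 'b) ring_scheme \<Rightarrow> 'a set \<Rightarrow> bool"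
  where "galois_extension L K \<longleftrightarrow> field L \<and> subfield K L \<and>
    (\<forall>x\<in>carrier L. ring.algebraic L K x) \<and>
    {x \<in> carrier L. \<forall>\<sigma>\<in>carrier (Gal L K). \<sigma> x = x} = K"

definition has_degree :: "('a, 'b) ring_scheme \<Rightarrow> 'a set \<Rightarrow> nat \<Rightarrow> bool"
  where "has_degree L K n \<longleftrightarrow> ring.dimension L n K (carrier L)"

text \<open>The Galois group of the curve \<open>F\<close> over \<open>K\<^sub>P\<close> extends to a subgroup of \<open>\<Gamma>\<close>.\<close>

definition extends_to_subgroup ::
    "(3, 'k::field) mpoly \<Rightarrow> (2 \<Rightarrow> (3, 'k) mpoly) \<Rightarrow> (3 \<Rightarrow> (3, 'k) mpoly) set set \<Rightarrow> bool"
  where "extends_to_subgroup F l \<Gamma> \<longleftrightarrow>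
    (\<exists>H. subgroup H Bir_P2 \<and> H \<subseteq> \<Gamma> \<and> (\<forall>\<phi>\<in>H. preserves F \<phi>) \<and>
      (\<lambda>\<phi>. field_aut F (restrict_to F \<phi>))
        \<in> iso (Bir_P2\<lparr>carrier := H\<rparr>) (Gal (function_field F) (pencil_field F l)))"

end

theory Submission
  imports Defs
begin

text \<open>Let \<open>y\<close> be an affine coordinate on the lines through the point \<open>p\<close>, so that the function field
  of the curve is generated by \<open>y\<close> over \<open>K\<close>. A fractional linear transformation of \<open>y\<close> with
  coefficients in \<open>K\<close> is a birational map of the plane preserving the lines through \<open>p\<close>, so it
  suffices to write \<open>\<sigma> y\<close>, for \<open>\<sigma>\<close> in the Galois group, as such a transform of \<open>y\<close> in a way that is
  compatible with composition. If \<open>y\<close> has degree at most 2 over \<open>K\<close>, then \<open>\<sigma> y\<close> is \<open>y\<close> or \<open>s - y\<close>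
  with \<open>s\<close> in \<open>K\<close> independent of \<open>\<sigma>\<close>. Otherwise \<open>1\<close>, \<open>y\<close>, \<open>\<sigma> y\<close>, \<open>y \<sigma> y\<close> are linearly dependent
  over \<open>K\<close>, the degree being at most 3; this gives the transformation, and it is unique, hence
  multiplicative in \<open>\<sigma>\<close>, because \<open>1\<close>, \<open>y\<close>, \<open>y\<^sup>2\<close> are linearly independent.\<close>

section \<open>Evaluation and homogeneity\<close>

text \<open>The obstacle is that the Galois action yields identities only modulo \<open>F\<close>,
  that is, on the curve, whereas a group of plane maps needs identities between polynomials. The
  bridge is that the coefficients of the transformations are forms in \<open>l 0\<close> and
  \<open>l 1\<close>, and that \<open>F\<close> divides no nonzero form of this kind once
  \<open>1\<close>, \<open>y\<close>, \<open>y^2\<close> are independent and the degree is at most 3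
  (\<open>binary_form_eq_0\<close>). Equality of two transformations at \<open>y\<close> is a
  relation of degree at most 2 in \<open>y\<close>; independence makes its coefficients vanish on
  the curve, and the bridge makes them vanish as polynomials. For quadratic \<open>y\<close> a
  transformation is not determined by its value at \<open>y\<close>, so an arbitrary choice need not
  be multiplicative; the involution sending \<open>y\<close> to \<open>s - y\<close> is used because
  its square is the identity for every value of \<open>y\<close>, not only on the curve. The bound 3
  enters by counting: four elements of a space of dimension at most 3 are dependent. No determinant
  of a transformation is computed: invertibility is inherited from the inverse in the Galois
  group.\<close>

lemma poly_mapping_sum_single:
  "A = (\<Sum>m\<in>Poly_Mapping.keys A. Poly_Mapping.single m (Poly_Mapping.lookup A m))"
proof (rule poly_mapping_eqI)
  fix m
  have "(\<Sum>m'\<in>Poly_Mapping.keys A. Poly_Mapping.lookup A m' when m' = m) = Poly_Mapping.lookup A m"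
    by (cases "m \<in> Poly_Mapping.keys A")
      (auto simp: when_def sum.delta' not_in_keys_iff_lookup_eq_zero)
  then show "Poly_Mapping.lookup A m =
    Poly_Mapping.lookup (\<Sum>m\<in>Poly_Mapping.keys A. Poly_Mapping.single m (Poly_Mapping.lookup A m)) m"
    by (simp add: lookup_sum lookup_single)
qed

lemma poly_mapping_induct [case_names zero single add]:
  assumes "P 0" and "\<And>m c. P (Poly_Mapping.single m c)" and "\<And>A B. P A \<Longrightarrow> P B \<Longrightarrow> P (A + B)"
  shows "P (A :: 'a \<Rightarrow>\<^sub>0 'b::comm_monoid_add)"
proof -
  have "P (\<Sum>m\<in>S. Poly_Mapping.single m (f m))" if "finite S" for S f
    using that by (induction S) (auto intro: assms)
  then show ?thesis
    by (subst poly_mapping_sum_single) auto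
qed

definition monomial_value :: "('n::finite \<Rightarrow> 'r) \<Rightarrow> ('n \<Rightarrow>\<^sub>0 nat) \<Rightarrow> 'r::comm_semiring_1"
  where "monomial_value v m = (\<Prod>i\<in>UNIV. v i ^ Poly_Mapping.lookup m i)"

lemma monomial_value_0 [simp]: "monomial_value v 0 = 1"
  by (simp add: monomial_value_def)

lemma monomial_value_add: "monomial_value v (m + n) = monomial_value v m * monomial_value v n"
  by (simp add: monomial_value_def lookup_add power_add prod.distrib)

lemma monomial_value_single: "monomial_value v (Poly_Mapping.single i n) = v i ^ n"
proof -
  have "monomial_value v (Poly_Mapping.single i n) = (\<Prod>j\<in>UNIV. if j = i then v j ^ n else 1)"
    unfolding monomial_value_def by (intro prod.cong) (auto simp: lookup_single when_def)
  then show ?thesis by simp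
qed

text \<open>The coefficient map is kept abstract because several occur: \<open>const\<close> gives
  substitution, the identity gives values at points, and the passage to constant polynomials in an
  extra variable gives \<open>translate\<close>.\<close>

locale coefficient_hom =
  fixes h :: "'k::comm_semiring_1 \<Rightarrow> 'r::comm_semiring_1"
  assumes h_0: "h 0 = 0" and h_1: "h 1 = 1"
    and h_add: "h (a + b) = h a + h b" and h_mult: "h (a * b) = h a * h b"
begin

lemma evaluate_superset:
  assumes "finite S" "Poly_Mapping.keys P \<subseteq> S"
  shows "evaluate h v P = (\<Sum>m\<in>S. h (Poly_Mapping.lookup P m) * monomial_value v m)"
  unfolding evaluate_def monomial_value_def
  by (rule sum.mono_neutral_left) (use assms in \<open>auto simp: in_keys_iff h_0\<close>)

lemma evaluate_0 [simp]: "evaluate h v 0 = 0"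
  by (simp add: evaluate_def)

lemma evaluate_add: "evaluate h v (P + Q) = evaluate h v P + evaluate h v Q"
proof -
  let ?S = "Poly_Mapping.keys P \<union> Poly_Mapping.keys Q"
  have "evaluate h v (P + Q) = (\<Sum>m\<in>?S. h (Poly_Mapping.lookup (P + Q) m) * monomial_value v m)"
    by (rule evaluate_superset) (auto simp: Poly_Mapping.keys_add)
  also have "\<dots> = evaluate h v P + evaluate h v Q"
    by (simp add: evaluate_superset[of ?S P] evaluate_superset[of ?S Q] lookup_add h_add
        distrib_right sum.distrib)
  finally show ?thesis .
qed

lemma evaluate_single: "evaluate h v (Poly_Mapping.single m c) = h c * monomial_value v m"
  by (simp add: evaluate_superset[of "{m}"] h_0)

lemma evaluate_mult: "evaluate h v (P * Q) = evaluate h v P * evaluate h v Q"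
proof (induction P rule: poly_mapping_induct)
  case (single m c)
  show ?case
  proof (induction Q rule: poly_mapping_induct)
    case (single n d)
    show ?case by (simp add: mult_single evaluate_single monomial_value_add h_mult ac_simps)
  qed (simp_all add: evaluate_add distrib_left)
qed (simp_all add: evaluate_add distrib_right)

lemma evaluate_const [simp]: "evaluate h v (const c) = h c"
  by (simp add: const_def evaluate_single)

lemma evaluate_coord [simp]: "evaluate h v (coord i) = v i"
  by (simp add: coord_def evaluate_single monomial_value_single h_1)

lemma evaluate_1 [simp]: "evaluate h v 1 = 1"
  using evaluate_single[of v 0 1] by (simp add: h_1)

lemma evaluate_power: "evaluate h v (P ^ n) = evaluate h v P ^ n"
  by (induction n) (simp_all add: evaluate_mult)

lemma evaluate_sum: "evaluate h v (\<Sum>i\<in>S. f i) = (\<Sum>i\<in>S. evaluate h v (f i))"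
  by (induction S rule: infinite_finite_induct) (simp_all add: evaluate_add)

lemma evaluate_prod: "evaluate h v (\<Prod>i\<in>S. f i) = (\<Prod>i\<in>S. evaluate h v (f i))"
  by (induction S rule: infinite_finite_induct) (simp_all add: evaluate_mult)

end

lemma const_0 [simp]: "const 0 = 0" and const_1 [simp]: "const 1 = 1"
  by (simp_all add: const_def)

lemma const_add: "const (a + b) = const a + const b"
  by (simp add: const_def single_add)

lemma const_mult: "const (a * b) = const a * const b"
  by (simp add: const_def mult_single)

lemma const_uminus: "const (- a) = - const a"
  by (simp add: const_def single_uminus)

interpretation subst: coefficient_hom "const :: 'k::comm_semiring_1 \<Rightarrow> ('n, 'k) mpoly"
  by unfold_locales (simp_all add: const_add const_mult)

interpretation value_at: coefficient_hom "\<lambda>c::'k::comm_semiring_1. c"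
  by unfold_locales simp_all

lemma subst_uminus: "subst v (- P) = - subst v P"
proof -
  have "subst v P + subst v (- P) = subst v (P + - P)"
    by (rule subst.evaluate_add[symmetric])
  also have "\<dots> = 0"
    by simp
  finally show ?thesis
    by (rule minus_unique[symmetric])
qed

lemma subst_diff: "subst v (P - Q) = subst v P - subst v Q"
proof -
  have "subst v (P + - Q) = subst v P + subst v (- Q)"
    by (rule subst.evaluate_add)
  then show ?thesis
    by (simp add: subst_uminus)
qed

lemma (in coefficient_hom) evaluate_subst:
  fixes v :: "'n::finite \<Rightarrow> ('m::finite, 'k) mpoly"
  shows "evaluate h w (evaluate const v A) = evaluate h (\<lambda>i. evaluate h w (v i)) A"
  by (induction A rule: poly_mapping_induct)
    (simp_all add: evaluate_add evaluate_mult subst.evaluate_add evaluate_single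
      subst.evaluate_single monomial_value_def evaluate_prod evaluate_power)

lemma coord_power: "coord i ^ n = Poly_Mapping.single (Poly_Mapping.single i n) (1::'k::comm_semiring_1)"
  by (induction n) (simp_all add: coord_def mult_single flip: single_add)

lemma monomial_value_coord:
  "monomial_value (coord :: 'n::finite \<Rightarrow> ('n, 'k::comm_semiring_1) mpoly) m = Poly_Mapping.single m 1"
proof -
  have *: "(\<Prod>i\<in>S. Poly_Mapping.single (f i) (1::'k)) = Poly_Mapping.single (\<Sum>i\<in>S. f i) 1"
    if "finite S" for S :: "'n set" and f :: "'n \<Rightarrow> 'n \<Rightarrow>\<^sub>0 nat"
    using that by (induction S) (simp_all add: mult_single)
  have "(\<Sum>i\<in>UNIV. Poly_Mapping.single i (Poly_Mapping.lookup m i)) = m"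
    by (rule poly_mapping_eqI) (simp add: lookup_sum lookup_single when_def)
  then show ?thesis
    by (simp add: monomial_value_def coord_power *)
qed

lemma subst_coord [simp]: "subst coord A = A"
proof (induction A rule: poly_mapping_induct)
  case (single m c)
  show ?case
    by (simp add: subst.evaluate_single monomial_value_coord) (simp add: const_def mult_single)
qed (simp_all add: subst.evaluate_add)

section \<open>Total degree and homogeneous forms\<close>

definition total_degree :: "('n::finite \<Rightarrow>\<^sub>0 nat) \<Rightarrow> nat"
  where "total_degree m = (\<Sum>i\<in>UNIV. Poly_Mapping.lookup m i)"

lemma total_degree_0 [simp]: "total_degree 0 = 0"
  by (simp add: total_degree_def)

lemma total_degree_add: "total_degree (m + n) = total_degree m + total_degree n"
  by (simp add: total_degree_def lookup_add sum.distrib)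

lemma total_degree_single [simp]: "total_degree (Poly_Mapping.single i n) = n"
  by (simp add: total_degree_def lookup_single when_def)

lemma total_degree_eq_0_iff [simp]: "total_degree m = 0 \<longleftrightarrow> m = 0"
  by (auto simp: total_degree_def intro!: poly_mapping_eqI)

lemma homogeneous_iff: "homogeneous d A \<longleftrightarrow> (\<forall>m\<in>Poly_Mapping.keys A. total_degree m = d)"
  by (simp add: homogeneous_def total_degree_def)

lemma homogeneous_0 [simp]: "homogeneous d 0"
  by (simp add: homogeneous_iff)

lemma homogeneous_const [simp]: "homogeneous 0 (const c)"
  by (simp add: homogeneous_iff const_def)

lemma homogeneous_1 [simp]: "homogeneous 0 1"
  by (simp add: homogeneous_iff)

lemma homogeneous_coord [simp]: "homogeneous (Suc 0) (coord i)"
  by (simp add: homogeneous_iff coord_def)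

lemma homogeneous_add: "homogeneous d A \<Longrightarrow> homogeneous d B \<Longrightarrow> homogeneous d (A + B)"
  using Poly_Mapping.keys_add[of A B] by (fastforce simp: homogeneous_iff)

lemma homogeneous_uminus: "homogeneous d A \<Longrightarrow> homogeneous d (- A :: ('n::finite, 'k::ab_group_add) mpoly)"
  by (simp add: homogeneous_iff in_keys_iff)

lemma homogeneous_diff:
  "homogeneous d A \<Longrightarrow> homogeneous d B \<Longrightarrow> homogeneous d (A - B :: ('n::finite, 'k::ab_group_add) mpoly)"
  using homogeneous_add[of d A "- B"] homogeneous_uminus[of d B] by simp

lemma homogeneous_mult: "homogeneous d A \<Longrightarrow> homogeneous e B \<Longrightarrow> homogeneous (d + e) (A * B)"
  using keys_mult[of A B] by (fastforce simp: homogeneous_iff total_degree_add)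

lemma homogeneous_power: "homogeneous d A \<Longrightarrow> homogeneous (n * d) (A ^ n)"
  by (induction n) (simp_all add: homogeneous_mult)

text \<open>A monomial of positive degree has a variable that can be split off. Induction by
  multiplication with one coordinate suits statements about \<open>subst\<close>, and later about a
  field automorphism, because both are multiplicative and known on coordinates.\<close>

lemma homogeneous_induct [consumes 1, case_names zero const coord add]:
  assumes "homogeneous d A"
    and zero: "\<And>d. P d 0" and const: "\<And>c. P 0 (const c)"
    and coord: "\<And>d A i. homogeneous d A \<Longrightarrow> P d A \<Longrightarrow> P (Suc d) (coord i * A)"
    and add: "\<And>d A B. homogeneous d A \<Longrightarrow> homogeneous d B \<Longrightarrow> P d A \<Longrightarrow> P d B \<Longrightarrow> P d (A + B)"
  shows "P d (A :: ('n::finite, 'k::comm_semiring_1) mpoly)"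
proof -
  have single: "P (total_degree m) (Poly_Mapping.single m c)" for m :: "'n \<Rightarrow>\<^sub>0 nat" and c :: 'k
  proof (induction "total_degree m" arbitrary: m)
    case 0
    then show ?case using const[of c] by (simp add: const_def)
  next
    case (Suc d)
    then have "m \<noteq> 0" by auto
    then obtain i where i: "Poly_Mapping.lookup m i \<noteq> 0"
      by (metis lookup_zero poly_mapping_eqI)
    define m' where "m' = m - Poly_Mapping.single i 1"
    have m: "m = Poly_Mapping.single i 1 + m'"
      using i by (intro poly_mapping_eqI)
        (auto simp: m'_def lookup_add lookup_minus lookup_single when_def)
    then have d: "d = total_degree m'"
      using Suc by (simp add: total_degree_add)
    have "P (Suc d) (coord i * Poly_Mapping.single m' c)"
      using Suc(1)[of m'] d by (intro coord) (auto simp: homogeneous_iff)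
    then show ?case using Suc(2) by (simp add: m coord_def mult_single)
  qed
  have "P d (\<Sum>m\<in>S. Poly_Mapping.single m (f m)) \<and> homogeneous d (\<Sum>m\<in>S. Poly_Mapping.single m (f m))"
    if "finite S" "\<forall>m\<in>S. total_degree m = d" for S and f :: "('n \<Rightarrow>\<^sub>0 nat) \<Rightarrow> 'k"
    using that
  proof (induction S)
    case (insert m S)
    moreover have "homogeneous d (Poly_Mapping.single m (f m))"
      using insert by (simp add: homogeneous_iff)
    ultimately show ?case
      using single[of m "f m"] by (auto intro: add homogeneous_add)
  qed (simp add: zero)
  then have "P d (\<Sum>m\<in>Poly_Mapping.keys A. Poly_Mapping.single m (Poly_Mapping.lookup A m))"
    using assms(1) by (simp add: homogeneous_iff)
  then show ?thesis by (simp flip: poly_mapping_sum_single)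
qed

lemma homogeneous_subst:
  assumes "homogeneous d A" "\<And>i. homogeneous e (\<Phi> i)"
  shows "homogeneous (d * e) (subst \<Phi> A)"
  using assms(1)
  by (induction d A rule: homogeneous_induct)
    (use assms(2) in \<open>auto simp: subst.evaluate_add subst.evaluate_mult intro: homogeneous_add homogeneous_mult\<close>)

lemma homogeneous_0_obtains:
  assumes "homogeneous 0 A"
  obtains c where "A = const c"
proof -
  have "A = const (Poly_Mapping.lookup A 0)"
  proof (rule poly_mapping_eqI)
    fix m
    show "Poly_Mapping.lookup A m = Poly_Mapping.lookup (const (Poly_Mapping.lookup A 0)) m"
      using assms by (cases "m = 0")
        (auto simp: const_def lookup_single homogeneous_iff in_keys_iff)
  qed
  then show thesis by (rule that)
qed

lemma linear_form:
  assumes "homogeneous 1 (A :: ('n::finite, 'k::comm_semiring_1) mpoly)"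
  obtains c where "A = (\<Sum>i\<in>UNIV. const (c i) * coord i)"
proof -
  have "\<exists>c. A = (\<Sum>i\<in>UNIV. const (c i) * coord i)"
    using assms
  proof (induction "1::nat" A rule: homogeneous_induct)
    case zero
    show ?case by (intro exI[of _ "\<lambda>_. 0"]) simp
  next
    case (coord d A i)
    then obtain c where "A = const c" using homogeneous_0_obtains by auto
    have "(\<Sum>j\<in>UNIV. const (if j = i then c else 0) * coord j :: ('n, 'k) mpoly)
      = (\<Sum>j\<in>UNIV. if j = i then coord j * const c else 0)"
      by (intro sum.cong) (auto simp: mult.commute)
    then have "coord i * A = (\<Sum>j\<in>UNIV. const (if j = i then c else 0) * coord j)"
      using \<open>A = const c\<close> by simp
    then show ?case by (intro exI[of _ "\<lambda>j. if j = i then c else 0"])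
  next
    case (add A B)
    then obtain c d where "A = (\<Sum>i\<in>UNIV. const (c i) * coord i)" "B = (\<Sum>i\<in>UNIV. const (d i) * coord i)"
      by blast
    then have "A + B = (\<Sum>i\<in>UNIV. const (c i + d i) * coord i)"
      by (simp add: const_add distrib_right sum.distrib)
    then show ?case by (intro exI[of _ "\<lambda>i. c i + d i"])
  qed simp
  then show thesis using that by blast
qed

text \<open>By homogeneity \<open>s ^ d * A(\<Phi>) = A(s \<Phi>)\<close>, and
  \<open>s \<Phi>\<close> is congruent to \<open>t \<Psi>\<close>. For two representatives of one
  rational map, \<open>s\<close> and \<open>t\<close> are taken to be their components at a common
  index.\<close>

lemma dvd_subst_congruence:
  assumes "homogeneous d A" and "\<And>i. F dvd s * \<Phi> i - t * \<Psi> i"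
  shows "F dvd s ^ d * subst \<Phi> A - t ^ d * subst \<Psi> A"
  using assms(1)
proof (induction d A rule: homogeneous_induct)
  case (coord d A i)
  have "s ^ Suc d * subst \<Phi> (coord i * A) - t ^ Suc d * subst \<Psi> (coord i * A)
    = s * \<Phi> i * (s ^ d * subst \<Phi> A - t ^ d * subst \<Psi> A) + t ^ d * subst \<Psi> A * (s * \<Phi> i - t * \<Psi> i)"
    by (simp add: subst.evaluate_mult algebra_simps)
  then show ?case using coord assms(2)[of i] by (simp add: dvd_add)
next
  case (add d A B)
  have "s ^ d * subst \<Phi> (A + B) - t ^ d * subst \<Psi> (A + B)
    = (s ^ d * subst \<Phi> A - t ^ d * subst \<Psi> A) + (s ^ d * subst \<Phi> B - t ^ d * subst \<Psi> B)"
    by (simp add: subst.evaluate_add algebra_simps)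
  then show ?case using add by (simp add: dvd_add)
qed simp_all

lemma subst_scale:
  assumes "homogeneous d A"
  shows "subst (\<lambda>i. t * \<Psi> i) A = t ^ d * subst \<Psi> A"
  \<comment> \<open>Divisibility by \<open>0\<close> is equality, so the congruence becomes an
    identity.\<close>
  using dvd_subst_congruence[OF assms, of 0 1 "\<lambda>i. t * \<Psi> i" t \<Psi>] by simp

text \<open>A lower bound for the order of vanishing at the origin. It is used on the cofactor of a
  form, which is not known to be homogeneous.\<close>

definition order_at_least :: "nat \<Rightarrow> ('n::finite, 'k::zero) mpoly \<Rightarrow> bool"
  where "order_at_least d A \<longleftrightarrow> (\<forall>m\<in>Poly_Mapping.keys A. d \<le> total_degree m)"

lemma order_at_least_mult:
  "order_at_least d A \<Longrightarrow> order_at_least e B \<Longrightarrow> order_at_least (d + e) (A * B)"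
  using keys_mult[of A B] by (fastforce simp: order_at_least_def total_degree_add intro: add_mono)

lemma order_at_least_homogeneous: "homogeneous e A \<Longrightarrow> d \<le> e \<Longrightarrow> order_at_least d A"
  by (simp add: order_at_least_def homogeneous_iff)

lemma order_at_least_diff_const: "order_at_least 1 (A - const (Poly_Mapping.lookup A 0))"
  for A :: "('n::finite, 'k::ab_group_add) mpoly"
proof -
  have "m \<noteq> 0" if "m \<in> Poly_Mapping.keys (A - const (Poly_Mapping.lookup A 0))" for m
    using that by (auto simp: in_keys_iff lookup_minus const_def)
  then show ?thesis
    by (auto simp: order_at_least_def Suc_le_eq intro: gr_zeroI)
qed

lemma homogeneous_order_at_least_eq_0:
  "homogeneous d A \<Longrightarrow> order_at_least e A \<Longrightarrow> d < e \<Longrightarrow> A = 0"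
  by (metis homogeneous_iff lookup_zero not_in_keys_iff_lookup_eq_zero order_at_least_def
      poly_mapping_eqI leD)

text \<open>In \<open>A = F * G\<close> replace \<open>G\<close> by its constant term
  \<open>c\<close>: the error has only terms of degree above \<open>d\<close>. If
  \<open>d = 1\<close>, then \<open>A - c F\<close> is linear and therefore zero; if
  \<open>d > 1\<close>, then already \<open>F * G\<close> has order above 1, so
  \<open>A = 0\<close>.\<close>

lemma linear_multiple_of_form:
  fixes A F :: "('n::finite, 'k::comm_ring_1) mpoly"
  assumes "homogeneous 1 A" "homogeneous d F" "0 < d" "F dvd A"
  obtains c where "A = const c * F"
proof -
  obtain G where G: "A = F * G"
    using assms(4) by blast
  define c where "c = Poly_Mapping.lookup G 0"
  have "order_at_least (d + 1) (F * (G - const c))"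
    using assms(2) unfolding c_def
    by (intro order_at_least_mult order_at_least_diff_const) (auto intro: order_at_least_homogeneous)
  then have *: "order_at_least (d + 1) (A - const c * F)"
    by (simp add: G algebra_simps)
  show thesis
  proof (cases "d = 1")
    case True
    then have "homogeneous 1 (A - const c * F)"
      using assms homogeneous_mult[of 0 "const c" 1 F] by (intro homogeneous_diff) auto
    then have "A - const c * F = 0"
      using * by (rule homogeneous_order_at_least_eq_0) (use True in auto)
    then show thesis by (intro that[of c]) simp
  next
    case False
    have "order_at_least d F"
      using assms(2) by (rule order_at_least_homogeneous) simp
    then have "order_at_least (d + 0) (F * G)"
      by (intro order_at_least_mult) (simp_all add: order_at_least_def)
    then have "A = 0"
      using assms(1,3) False by (intro homogeneous_order_at_least_eq_0[of 1 A d]) (auto simp: G)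
    then show thesis by (intro that[of 0]) simp
  qed
qed

lemma subst_dvd_mono: "F dvd A \<Longrightarrow> subst \<Phi> F dvd subst \<Phi> A"
  by (auto simp: subst.evaluate_mult)

section \<open>The group of birational self-maps\<close>

text \<open>The operations on classes are unions over all representatives. Once each choice is shown
  to give the same class, this evaluates the union.\<close>

lemma UN_UN_constant:
  assumes "\<And>x y. x \<in> A \<Longrightarrow> y \<in> B \<Longrightarrow> f x y = c" "a \<in> A" "b \<in> B"
  shows "(\<Union>x\<in>A. \<Union>y\<in>B. f x y) = c"
proof -
  have "(\<Union>y\<in>B. f x y) = c" if "x \<in> A" for x
    using assms(1)[OF that] assms(3) by (auto intro: SUP_eq_const)
  then show ?thesis
    using assms(2) by (auto intro: SUP_eq_const)
qed

lemma comp_map_assoc: "comp_map (comp_map \<Phi> \<Psi>) \<Theta> = comp_map \<Phi> (comp_map \<Psi> \<Theta>)"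
  by (simp add: comp_map_def subst.evaluate_subst)

lemma comp_map_coord_left [simp]: "comp_map coord \<Psi> = \<Psi>"
  by (simp add: comp_map_def)

lemma comp_map_coord_right [simp]: "comp_map \<Phi> coord = \<Phi>"
  by (simp add: comp_map_def)

text \<open>Density of the image in algebraic form: a form that is nonzero on the hypersurface does
  not pull back to zero. This keeps composites from vanishing identically, so that composition
  descends to classes.\<close>

definition dominant :: "('n::finite, 'k::field) mpoly \<Rightarrow> ('n \<Rightarrow> ('n, 'k) mpoly) \<Rightarrow> bool"
  where "dominant F \<Psi> \<longleftrightarrow> self_map F \<Psi> \<and>
    (\<forall>d A. homogeneous d A \<longrightarrow> F dvd subst \<Psi> A \<longrightarrow> F dvd A)"

lemma same_map_sym: "same_map F \<Phi> \<Psi> \<Longrightarrow> same_map F \<Psi> \<Phi>"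
  unfolding same_map_def by (metis dvd_minus_iff minus_diff_eq mult.commute)

lemma same_map_refl: "rational_map F \<Phi> \<Longrightarrow> same_map F \<Phi> \<Phi>"
  by (simp add: same_map_def mult.commute)

lemma same_map_rational: "same_map F \<Phi> \<Psi> \<Longrightarrow> rational_map F \<Phi>" "same_map F \<Phi> \<Psi> \<Longrightarrow> rational_map F \<Psi>"
  by (simp_all add: same_map_def)

text \<open>Used both for \<open>F = 0\<close>, the plane, and for the curve. Primality is asked for
  forms only, since that is what the function field delivers; \<open>coord_not_dvd\<close> makes the
  identity a rational map.\<close>

locale hypersurface =
  fixes F :: "('n::finite, 'k::field) mpoly"
  assumes homogeneous_F: "\<exists>d. homogeneous d F"
    and prime: "homogeneous a A \<Longrightarrow> homogeneous b B \<Longrightarrow> F dvd A * B \<Longrightarrow> F dvd A \<or> F dvd B"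
    and coord_not_dvd: "\<exists>i. \<not> F dvd coord i"
begin

lemma nonunit: "\<not> F dvd 1"
  using coord_not_dvd by (metis dvd_trans one_dvd)

lemma prime_power: "homogeneous a A \<Longrightarrow> F dvd A ^ n \<Longrightarrow> F dvd A"
proof (induction n)
  case (Suc n)
  then show ?case using prime[of a A "n * a" "A ^ n"] by (auto intro: homogeneous_power)
qed (use nonunit in auto)

lemma dvd_cancel:
  assumes "F dvd A * B" "\<not> F dvd A" "homogeneous a A" "homogeneous b B"
  shows "F dvd B"
  using prime[OF assms(3,4,1)] assms(2) by blast

lemma dvd_cancel_power:
  assumes "F dvd A ^ n * B" "\<not> F dvd A" "homogeneous a A" "homogeneous b B"
  shows "F dvd B"
  using dvd_cancel[OF assms(1) _ homogeneous_power[OF assms(3)] assms(4)] prime_power[OF assms(3)] assms(2)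
  by blast

lemma same_map_trans:
  assumes "same_map F \<Phi> \<Psi>" "same_map F \<Psi> \<Theta>"
  shows "same_map F \<Phi> \<Theta>"
proof -
  obtain k where k: "\<not> F dvd \<Psi> k"
    using assms(2) by (auto simp: same_map_def rational_map_def)
  obtain d1 d2 d3 where d: "\<And>i. homogeneous d1 (\<Phi> i)" "\<And>i. homogeneous d2 (\<Psi> i)" "\<And>i. homogeneous d3 (\<Theta> i)"
    using assms unfolding same_map_def rational_map_def by metis
  have "F dvd \<Phi> i * \<Theta> j - \<Phi> j * \<Theta> i" for i j
  proof -
    \<comment> \<open>A component \<open>\<Psi> k\<close> that is nonzero on the hypersurface serves
      as the middle term: the desired relation times \<open>\<Psi> k\<close> is a combination of the
      given ones.\<close>
    have "F dvd (\<Phi> i * \<Psi> k - \<Phi> k * \<Psi> i) * \<Theta> j + \<Phi> k * (\<Psi> i * \<Theta> j - \<Psi> j * \<Theta> i)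
      - (\<Phi> j * \<Psi> k - \<Phi> k * \<Psi> j) * \<Theta> i"
      using assms by (simp add: same_map_def dvd_diff dvd_add del: dvd_add_left_iff)
    also have "\<dots> = \<Psi> k * (\<Phi> i * \<Theta> j - \<Phi> j * \<Theta> i)"
      by (simp add: algebra_simps)
    finally show ?thesis
      by (rule dvd_cancel[OF _ k d(2)]) (rule homogeneous_diff homogeneous_mult d)+
  qed
  then show ?thesis
    using assms by (simp add: same_map_def)
qed

lemma map_class_eq: "same_map F \<Phi> \<Psi> \<Longrightarrow> map_class F \<Phi> = map_class F \<Psi>"
  unfolding map_class_def
  using same_map_trans[of \<Phi> \<Psi>] same_map_trans[OF same_map_sym[of F \<Phi> \<Psi>]] by blast

lemma same_map_subst_dvd:
  assumes "same_map F \<Phi> \<Psi>" "homogeneous d A" "F dvd subst \<Psi> A"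
  shows "F dvd subst \<Phi> A"
proof -
  obtain k where k: "\<not> F dvd \<Psi> k"
    using assms(1) by (auto simp: same_map_def rational_map_def)
  obtain d1 d2 where d: "\<And>i. homogeneous d1 (\<Phi> i)" "\<And>i. homogeneous d2 (\<Psi> i)"
    using assms(1) unfolding same_map_def rational_map_def by metis
  have "F dvd \<Psi> k ^ d * subst \<Phi> A - \<Phi> k ^ d * subst \<Psi> A"
    using assms(1) by (intro dvd_subst_congruence[OF assms(2)]) (simp add: same_map_def mult.commute)
  from dvd_add[OF this dvd_mult[OF assms(3)], of "\<Phi> k ^ d"] have "F dvd \<Psi> k ^ d * subst \<Phi> A"
    by simp
  then show ?thesis
    by (rule dvd_cancel_power[OF _ k d(2)]) (rule homogeneous_subst assms d)+
qed

lemma self_map_coord: "self_map F coord"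
  unfolding self_map_def rational_map_def using coord_not_dvd by (auto intro: homogeneous_coord)

lemma self_map_same: "same_map F \<Phi> \<Psi> \<Longrightarrow> self_map F \<Phi> \<Longrightarrow> self_map F \<Psi>"
  using homogeneous_F same_map_subst_dvd[OF same_map_sym, of \<Phi> \<Psi> _ F]
    same_map_rational(2)[of F \<Phi> \<Psi>] unfolding self_map_def by blast

lemma dominant_same: "same_map F \<Phi> \<Psi> \<Longrightarrow> dominant F \<Phi> \<Longrightarrow> dominant F \<Psi>"
  using self_map_same[of \<Phi> \<Psi>] same_map_subst_dvd[of \<Phi> \<Psi>] unfolding dominant_def by blast

lemma dominant_dvd_iff:
  assumes "dominant F \<Psi>" "homogeneous d A"
  shows "F dvd subst \<Psi> A \<longleftrightarrow> F dvd A"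
  using assms subst_dvd_mono[of F A \<Psi>] unfolding dominant_def self_map_def by (meson dvd_trans)

lemma rational_map_comp:
  assumes "rational_map F \<Phi>" "dominant F \<Psi>"
  shows "rational_map F (comp_map \<Phi> \<Psi>)"
proof -
  obtain d where d: "\<And>i. homogeneous d (\<Phi> i)"
    using assms(1) by (auto simp: rational_map_def)
  obtain e where e: "\<And>i. homogeneous e (\<Psi> i)"
    using assms(2) by (auto simp: rational_map_def dominant_def self_map_def)
  obtain i where "\<not> F dvd \<Phi> i"
    using assms(1) by (auto simp: rational_map_def)
  then have "\<not> F dvd subst \<Psi> (\<Phi> i)"
    using dominant_dvd_iff[OF assms(2) d] by blast
  moreover have "\<forall>i. homogeneous (d * e) (subst \<Psi> (\<Phi> i))"
    by (intro allI homogeneous_subst d e)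
  ultimately show ?thesis
    by (auto simp: rational_map_def comp_map_def)
qed

lemma dominant_comp:
  assumes "dominant F \<Phi>" "dominant F \<Psi>"
  shows "dominant F (comp_map \<Phi> \<Psi>)"
proof -
  have subst: "subst (comp_map \<Phi> \<Psi>) A = subst \<Psi> (subst \<Phi> A)" for A
    by (simp add: comp_map_def subst.evaluate_subst)
  have "F dvd subst \<Psi> (subst \<Phi> F)"
    using assms subst_dvd_mono[of F "subst \<Phi> F" \<Psi>] unfolding dominant_def self_map_def
    by (meson dvd_trans)
  then have "self_map F (comp_map \<Phi> \<Psi>)"
    using rational_map_comp assms by (auto simp: self_map_def dominant_def subst)
  moreover have "F dvd A" if A: "homogeneous d A" "F dvd subst (comp_map \<Phi> \<Psi>) A" for d A
  proof -
    obtain e where "\<And>i. homogeneous e (\<Phi> i)"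
      using assms(1) by (auto simp: rational_map_def dominant_def self_map_def)
    then have "homogeneous (d * e) (subst \<Phi> A)"
      using homogeneous_subst A by blast
    then show ?thesis
      using A assms unfolding dominant_def subst by blast
  qed
  ultimately show ?thesis
    unfolding dominant_def by blast
qed

lemma same_map_comp_left:
  assumes "same_map F \<Phi> \<Phi>'" "dominant F \<Psi>"
  shows "same_map F (comp_map \<Phi> \<Psi>) (comp_map \<Phi>' \<Psi>)"
proof -
  have "F dvd subst \<Psi> (\<Phi> i) * subst \<Psi> (\<Phi>' j) - subst \<Psi> (\<Phi> j) * subst \<Psi> (\<Phi>' i)" for i j
  proof -
    have "subst \<Psi> F dvd subst \<Psi> (\<Phi> i * \<Phi>' j - \<Phi> j * \<Phi>' i)"
      using assms(1) by (intro subst_dvd_mono) (simp add: same_map_def)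
    then show ?thesis
      using assms(2) dvd_trans by (auto simp: subst_diff subst.evaluate_mult dominant_def self_map_def)
  qed
  then show ?thesis
    using assms rational_map_comp by (auto simp: same_map_def comp_map_def)
qed

text \<open>Two representatives pull the fraction \<open>A / B\<close> back to the same fraction:
  \<open>A\<close> and \<open>B\<close> have equal degree, so both satisfy congruences with the same
  multipliers, and the terms with \<open>?s ^ d\<close> cancel after cross multiplication.\<close>

lemma same_map_subst_cross:
  assumes "same_map F \<Psi> \<Psi>'" "homogeneous d A" "homogeneous d B"
  shows "F dvd subst \<Psi> A * subst \<Psi>' B - subst \<Psi> B * subst \<Psi>' A"
proof -
  obtain k where k: "\<not> F dvd \<Psi> k"
    using assms(1) by (auto simp: same_map_def rational_map_def)
  obtain d1 d2 where d12: "\<And>i. homogeneous d1 (\<Psi> i)" "\<And>i. homogeneous d2 (\<Psi>' i)"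
    using assms(1) unfolding same_map_def rational_map_def by metis
  let ?s = "\<Psi>' k" and ?t = "\<Psi> k"
  have *: "F dvd ?s ^ d * subst \<Psi> A - ?t ^ d * subst \<Psi>' A" if "homogeneous d A" for A
    using assms(1) by (intro dvd_subst_congruence[OF that]) (simp add: same_map_def mult.commute)
  have "F dvd subst \<Psi> B * (?s ^ d * subst \<Psi> A - ?t ^ d * subst \<Psi>' A)
    - subst \<Psi> A * (?s ^ d * subst \<Psi> B - ?t ^ d * subst \<Psi>' B)"
    by (intro dvd_diff dvd_mult * assms(2,3))
  also have "\<dots> = ?t ^ d * (subst \<Psi> A * subst \<Psi>' B - subst \<Psi> B * subst \<Psi>' A)"
    by (simp add: algebra_simps)
  finally show ?thesis
    by (rule dvd_cancel_power[OF _ k d12(1)])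
      (rule homogeneous_diff homogeneous_mult homogeneous_subst assms(2,3) d12)+
qed

lemma same_map_comp_right:
  assumes "same_map F \<Psi> \<Psi>'" "dominant F \<Psi>" "rational_map F \<Phi>"
  shows "same_map F (comp_map \<Phi> \<Psi>) (comp_map \<Phi> \<Psi>')"
proof -
  obtain d where "\<And>i. homogeneous d (\<Phi> i)"
    using assms(3) by (auto simp: rational_map_def)
  then have "F dvd subst \<Psi> (\<Phi> i) * subst \<Psi>' (\<Phi> j) - subst \<Psi> (\<Phi> j) * subst \<Psi>' (\<Phi> i)" for i j
    using same_map_subst_cross[OF assms(1)] by blast
  then show ?thesis
    using assms rational_map_comp dominant_same by (auto simp: same_map_def comp_map_def)
qed

lemma same_map_comp:
  assumes "same_map F \<Phi> \<Phi>'" "same_map F \<Psi> \<Psi>'" "dominant F \<Psi>"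
  shows "same_map F (comp_map \<Phi> \<Psi>) (comp_map \<Phi>' \<Psi>')"
  using same_map_trans same_map_comp_left[OF assms(1,3)] same_map_comp_right[OF assms(2,3)]
    same_map_rational(2)[OF assms(1)] by blast

text \<open>If \<open>A\<close> vanishes after substituting \<open>\<Psi>\<close>, substituting the
  inverse as well shows that it vanishes after the identity.\<close>

lemma birational_dominant:
  assumes "birational F \<Psi>"
  shows "dominant F \<Psi>"
proof -
  obtain \<Theta> where \<Theta>: "self_map F \<Psi>" "self_map F \<Theta>" "same_map F (comp_map \<Psi> \<Theta>) coord"
    using assms by (auto simp: birational_def)
  have "F dvd A" if A: "homogeneous d A" "F dvd subst \<Psi> A" for d A
  proof -
    have "subst \<Theta> F dvd subst \<Theta> (subst \<Psi> A)"
      by (intro subst_dvd_mono A)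
    then have "F dvd subst (comp_map \<Psi> \<Theta>) A"
      using \<Theta>(2) by (auto simp: self_map_def comp_map_def subst.evaluate_subst intro: dvd_trans)
    then show ?thesis
      using same_map_subst_dvd[OF same_map_sym[OF \<Theta>(3)] A(1)] by simp
  qed
  then show ?thesis
    using \<Theta>(1) by (auto simp: dominant_def)
qed

lemma birational_inverse:
  assumes "birational F \<Phi>"
  obtains \<Psi> where "birational F \<Psi>" "same_map F (comp_map \<Phi> \<Psi>) coord" "same_map F (comp_map \<Psi> \<Phi>) coord"
  using assms unfolding birational_def by blast

lemma birational_rational: "birational F \<Phi> \<Longrightarrow> rational_map F \<Phi>"
  by (simp add: birational_def self_map_def)

lemma birational_coord: "birational F coord"
  using self_map_coord same_map_refl unfolding birational_def
  by (metis comp_map_coord_left self_map_def)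

lemma birational_same:
  assumes "same_map F \<Phi> \<Psi>" "birational F \<Phi>"
  shows "birational F \<Psi>"
proof -
  obtain \<Theta> where \<Theta>: "birational F \<Theta>" "same_map F (comp_map \<Phi> \<Theta>) coord" "same_map F (comp_map \<Theta> \<Phi>) coord"
    using birational_inverse[OF assms(2)] .
  have "same_map F (comp_map \<Psi> \<Theta>) coord"
    using same_map_trans[OF same_map_sym[OF same_map_comp_left[OF assms(1) birational_dominant[OF \<Theta>(1)]]] \<Theta>(2)] .
  moreover have "same_map F (comp_map \<Theta> \<Psi>) coord"
    using same_map_trans[OF same_map_sym[OF same_map_comp_right[OF assms(1) birational_dominant[OF assms(2)]
            birational_rational[OF \<Theta>(1)]]] \<Theta>(3)] .
  moreover have "self_map F \<Psi>"
    using self_map_same assms birational_def by blast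
  ultimately show ?thesis
    using \<Theta>(1) unfolding birational_def by blast
qed

lemma comp_cancel:
  assumes "birational F \<Phi>" "birational F \<Phi>'" "birational F \<Psi>" "birational F \<Psi>'"
    and "same_map F (comp_map \<Phi> \<Phi>') coord" "same_map F (comp_map \<Psi> \<Psi>') coord"
  shows "same_map F (comp_map (comp_map \<Phi> \<Psi>) (comp_map \<Psi>' \<Phi>')) coord"
proof -
  have "same_map F (comp_map (comp_map \<Psi> \<Psi>') \<Phi>') (comp_map coord \<Phi>')"
    using assms by (intro same_map_comp_left birational_dominant)
  then have "same_map F (comp_map \<Phi> (comp_map (comp_map \<Psi> \<Psi>') \<Phi>')) (comp_map \<Phi> (comp_map coord \<Phi>'))"
    using assms by (intro same_map_comp_right dominant_comp birational_dominant birational_rational)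
  then show ?thesis
    using same_map_trans assms(5) by (simp add: comp_map_assoc) blast
qed

lemma birational_comp:
  assumes "birational F \<Phi>" "birational F \<Psi>"
  shows "birational F (comp_map \<Phi> \<Psi>)"
proof -
  obtain \<Phi>' where \<Phi>': "birational F \<Phi>'" "same_map F (comp_map \<Phi> \<Phi>') coord" "same_map F (comp_map \<Phi>' \<Phi>) coord"
    using birational_inverse[OF assms(1)] .
  obtain \<Psi>' where \<Psi>': "birational F \<Psi>'" "same_map F (comp_map \<Psi> \<Psi>') coord" "same_map F (comp_map \<Psi>' \<Psi>) coord"
    using birational_inverse[OF assms(2)] .
  have "self_map F (comp_map \<Phi> \<Psi>)" "self_map F (comp_map \<Psi>' \<Phi>')"
    using dominant_comp birational_dominant assms \<Phi>' \<Psi>' dominant_def by blast+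
  then show ?thesis
    unfolding birational_def
    using comp_cancel[OF assms(1) \<Phi>'(1) assms(2) \<Psi>'(1) \<Phi>'(2) \<Psi>'(2)]
      comp_cancel[OF \<Psi>'(1) assms(2) \<Phi>'(1) assms(1) \<Psi>'(3) \<Phi>'(3)] by blast
qed

lemma Bir_mult:
  assumes "birational F \<Phi>" "birational F \<Psi>"
  shows "map_class F \<Phi> \<otimes>\<^bsub>Bir F\<^esub> map_class F \<Psi> = map_class F (comp_map \<Phi> \<Psi>)"
proof -
  have "map_class F (comp_map \<Phi>' \<Psi>') = map_class F (comp_map \<Phi> \<Psi>)"
    if "\<Phi>' \<in> map_class F \<Phi>" "\<Psi>' \<in> map_class F \<Psi>" for \<Phi>' \<Psi>'
  proof -
    have "same_map F (comp_map \<Phi> \<Psi>) (comp_map \<Phi>' \<Psi>')"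
      using that assms by (intro same_map_comp birational_dominant) (auto simp: map_class_def)
    then show ?thesis by (rule map_class_eq[symmetric])
  qed
  moreover have "\<Phi> \<in> map_class F \<Phi>" "\<Psi> \<in> map_class F \<Psi>"
    using assms by (auto simp: map_class_def same_map_refl birational_rational)
  ultimately have "(\<Union>\<Phi>'\<in>map_class F \<Phi>. \<Union>\<Psi>'\<in>map_class F \<Psi>. map_class F (comp_map \<Phi>' \<Psi>'))
    = map_class F (comp_map \<Phi> \<Psi>)"
    by (rule UN_UN_constant)
  then show ?thesis
    by (simp only: Bir_def monoid.select_convs)
qed

lemma Bir_carrier: "x \<in> carrier (Bir F) \<longleftrightarrow> (\<exists>\<Phi>. birational F \<Phi> \<and> x = map_class F \<Phi>)"
  by (auto simp: Bir_def)

lemma Bir_one: "\<one>\<^bsub>Bir F\<^esub> = map_class F coord"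
  by (simp add: Bir_def)

lemma group_Bir: "group (Bir F)"
proof (rule groupI)
  fix x assume "x \<in> carrier (Bir F)"
  then obtain \<Phi> where \<Phi>: "birational F \<Phi>" "x = map_class F \<Phi>"
    by (auto simp: Bir_carrier)
  then obtain \<Psi> where "birational F \<Psi>" "same_map F (comp_map \<Psi> \<Phi>) coord"
    using birational_inverse by metis
  then show "\<exists>y\<in>carrier (Bir F). y \<otimes>\<^bsub>Bir F\<^esub> x = \<one>\<^bsub>Bir F\<^esub>"
    using \<Phi> by (intro bexI[of _ "map_class F \<Psi>"]) (auto simp: Bir_mult Bir_one Bir_carrier map_class_eq)
next
  fix x y assume "x \<in> carrier (Bir F)" "y \<in> carrier (Bir F)"
  then obtain \<Phi> \<Psi> where "birational F \<Phi>" "x = map_class F \<Phi>" "birational F \<Psi>" "y = map_class F \<Psi>"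
    by (auto simp: Bir_carrier)
  then show "x \<otimes>\<^bsub>Bir F\<^esub> y \<in> carrier (Bir F)"
    using birational_comp by (auto simp: Bir_carrier Bir_mult)
qed (auto simp: Bir_carrier Bir_mult Bir_one birational_comp birational_coord
    comp_map_assoc intro: exI[of _ coord])

lemma Bir_inv:
  assumes "birational F \<Phi>" "birational F \<Psi>" "same_map F (comp_map \<Psi> \<Phi>) coord"
  shows "inv\<^bsub>Bir F\<^esub> (map_class F \<Phi>) = map_class F \<Psi>"
  using assms by (intro group.inv_equality[OF group_Bir]) (auto simp: Bir_mult Bir_one Bir_carrier map_class_eq)

end

lemma coord_neq_0: "coord i \<noteq> (0 :: ('n, 'k::zero_neq_one) mpoly)"
proof
  assume "coord i = (0 :: ('n, 'k) mpoly)"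
  then have "Poly_Mapping.lookup (coord i :: ('n, 'k) mpoly) (Poly_Mapping.single i 1) = 0"
    by simp
  then show False
    by (simp add: coord_def)
qed

text \<open>Primality of \<open>0\<close> says that the polynomial ring is a domain; the order on
  the variables induces one on the monomials, so leading terms multiply.\<close>

lemma hypersurface_0: "hypersurface (0 :: ('n::{finite, linorder}, 'k::field) mpoly)"
  by unfold_locales (auto simp: coord_neq_0 intro: homogeneous_0)

section \<open>The function field and its automorphisms\<close>

lemma UN_UN_pair_constant:
  assumes "\<And>a b c d. (a, b) \<in> S \<Longrightarrow> (c, d) \<in> T \<Longrightarrow> f a b c d = z"
    and "(a0, b0) \<in> S" "(c0, d0) \<in> T"
  shows "(\<Union>(a, b)\<in>S. \<Union>(c, d)\<in>T. f a b c d) = z"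
  using assms UN_UN_constant[of S T "\<lambda>(a, b) (c, d). f a b c d" z "(a0, b0)" "(c0, d0)"]
  by (simp add: split_def)

lemma fractions_iff:
  "(A, B) \<in> fractions F \<longleftrightarrow> (\<exists>d. homogeneous d A \<and> homogeneous d B) \<and> \<not> F dvd B"
  by (simp add: fractions_def)

lemma fractionsI: "homogeneous d A \<Longrightarrow> homogeneous d B \<Longrightarrow> \<not> F dvd B \<Longrightarrow> (A, B) \<in> fractions F"
  by (auto simp: fractions_iff)

lemma frac_class_iff: "(A', B') \<in> frac_class F (A, B) \<longleftrightarrow>
    (A, B) \<in> fractions F \<and> (A', B') \<in> fractions F \<and> F dvd A * B' - A' * B"
  by (simp add: frac_class_def)

text \<open>In the function field the product of the class \<open>1\<close> with itself contains the class of
  \<open>(A, A)\<close>, to which \<open>(2 B, B)\<close> belongs as soon as \<open>A B\<close> vanishes on the hypersurface.\<close>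

lemma function_field_prime:
  fixes F :: "('n::finite, 'k::field) mpoly"
  assumes "monoid (function_field F)" "homogeneous a A" "homogeneous b B" "F dvd A * B"
  shows "F dvd A \<or> F dvd B"
proof (rule ccontr)
  assume "\<not> (F dvd A \<or> F dvd B)"
  then have A: "\<not> F dvd A" and B: "\<not> F dvd B" by auto
  have 1: "\<not> F dvd 1"
    using A by (meson dvd_trans one_dvd)
  let ?one = "frac_class F (1, 1)"
  have "(A, A) \<in> ?one" "(1, 1) \<in> ?one"
    using A 1 assms(2) fractionsI[OF homogeneous_1 homogeneous_1 1] by (auto simp: frac_class_iff intro: fractionsI)
  then have "frac_class F (A * 1, A * 1) \<subseteq> mult (function_field F) ?one ?one"
    unfolding function_field_def by fastforce
  also have "\<dots> = ?one"
    using monoid.l_one[OF assms(1) monoid.one_closed[OF assms(1)]] by (simp add: function_field_def)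
  finally have "frac_class F (A, A) \<subseteq> ?one" by simp
  moreover have "(B + B, B) \<in> frac_class F (A, A)"
  proof -
    have "A * B - (B + B) * A = - (A * B)"
      by (simp add: algebra_simps)
    then have "F dvd A * B - (B + B) * A"
      using assms(4) by simp
    moreover have "(B + B, B) \<in> fractions F"
      by (rule fractionsI[OF homogeneous_add]) (rule assms B)+
    ultimately show ?thesis
      using fractionsI[OF assms(2,2) A] by (simp only: frac_class_iff simp_thms)
  qed
  ultimately have "(B + B, B) \<in> ?one" by blast
  \<comment> \<open>Membership of \<open>(2 B, B)\<close> in the class of 1 forces \<open>F\<close>
    to divide \<open>2 B - B\<close>.\<close>
  then have "F dvd 1 * B - (B + B) * 1"
    unfolding frac_class_iff by blast
  also have "1 * B - (B + B) * 1 = - B"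
    by simp
  finally show False
    using B by simp
qed

context hypersurface
begin

abbreviation L where "L \<equiv> function_field F"

abbreviation ratio :: "('n, 'k) mpoly \<Rightarrow> ('n, 'k) mpoly \<Rightarrow> (('n, 'k) mpoly \<times> ('n, 'k) mpoly) set"
  where "ratio A B \<equiv> frac_class F (A, B)"

lemma not_dvd_mult: "homogeneous a A \<Longrightarrow> homogeneous b B \<Longrightarrow> \<not> F dvd A \<Longrightarrow> \<not> F dvd B \<Longrightarrow> \<not> F dvd A * B"
  using prime by blast

lemma not_dvd_power: "homogeneous a A \<Longrightarrow> \<not> F dvd A \<Longrightarrow> \<not> F dvd A ^ n"
  using prime_power by blast

lemma fractions_mult:
  "(A, B) \<in> fractions F \<Longrightarrow> (C, D) \<in> fractions F \<Longrightarrow> (A * C, B * D) \<in> fractions F"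
  unfolding fractions_iff by (meson homogeneous_mult not_dvd_mult)

lemma fractions_add:
  "(A, B) \<in> fractions F \<Longrightarrow> (C, D) \<in> fractions F \<Longrightarrow> (A * D + C * B, B * D) \<in> fractions F"
  unfolding fractions_iff by (metis homogeneous_mult homogeneous_add not_dvd_mult add.commute)

lemma frac_eq_iff:
  assumes AB: "(A, B) \<in> fractions F" and CD: "(C, D) \<in> fractions F"
  shows "ratio A B = ratio C D \<longleftrightarrow> F dvd A * D - C * B"
proof
  assume "ratio A B = ratio C D"
  moreover have "(C, D) \<in> ratio C D"
    using CD by (simp add: frac_class_iff)
  ultimately have "(C, D) \<in> ratio A B"
    by simp
  then show "F dvd A * D - C * B"
    unfolding frac_class_iff by blast
next
  assume *: "F dvd A * D - C * B"
  have sub: "ratio A B \<subseteq> ratio C D"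
    if AB: "(A, B) \<in> fractions F" and CD: "(C, D) \<in> fractions F" and *: "F dvd A * D - C * B"
    for A B C D
  proof (rule subrelI)
    fix U V assume UV: "(U, V) \<in> ratio A B"
    from UV have UV': "(U, V) \<in> fractions F" "F dvd A * V - U * B"
      by (auto simp: frac_class_iff)
    from AB obtain a where a: "homogeneous a A" "homogeneous a B" "\<not> F dvd B" by (auto simp: fractions_iff)
    from CD obtain c where c: "homogeneous c C" "homogeneous c D" by (auto simp: fractions_iff)
    from UV'(1) obtain d where d: "homogeneous d U" "homogeneous d V" by (auto simp: fractions_iff)
    have "homogeneous (c + d) (C * V - U * D)"
      using homogeneous_diff[OF homogeneous_mult[OF c(1) d(2)]] homogeneous_mult[OF d(1) c(2)]
      by (simp add: add.commute)
    moreover have "F dvd B * (C * V - U * D)"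
    proof -
      have "F dvd (A * V - U * B) * D - (A * D - C * B) * V"
        by (rule dvd_diff[OF dvd_mult2[OF UV'(2)] dvd_mult2[OF *]])
      also have "(A * V - U * B) * D - (A * D - C * B) * V = B * (C * V - U * D)"
        by (simp add: algebra_simps)
      finally show ?thesis .
    qed
    ultimately have "F dvd C * V - U * D"
      using dvd_cancel a by blast
    then show "(U, V) \<in> ratio C D"
      using CD UV' by (simp add: frac_class_iff)
  qed
  have "F dvd - (A * D - C * B)"
    using * by (simp only: dvd_minus_iff)
  then have "F dvd C * B - A * D"
    by simp
  then show "ratio A B = ratio C D"
    using sub[OF AB CD *] sub[OF CD AB] by blast
qed

lemma frac_mem: "(A, B) \<in> ratio C D \<longleftrightarrow> (A, B) \<in> fractions F \<and> (C, D) \<in> fractions F \<and> ratio A B = ratio C D"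
  using frac_eq_iff[of C D A B] by (auto simp: frac_class_iff)

lemma frac_closed: "(A, B) \<in> fractions F \<Longrightarrow> ratio A B \<in> carrier L"
  by (auto simp: function_field_def)

lemma function_field_cases:
  assumes "x \<in> carrier L"
  obtains A B where "(A, B) \<in> fractions F" "x = ratio A B"
  using assms by (auto simp: function_field_def)

lemma frac_mult:
  assumes AB: "(A, B) \<in> fractions F" and CD: "(C, D) \<in> fractions F"
  shows "ratio A B \<otimes>\<^bsub>L\<^esub> ratio C D = ratio (A * C) (B * D)"
proof -
  have "(\<Union>(A, B)\<in>ratio A B. \<Union>(C, D)\<in>ratio C D. ratio (A * C) (B * D)) = ratio (A * C) (B * D)"
  proof (rule UN_UN_pair_constant)
    fix A' B' C' D' assume "(A', B') \<in> ratio A B" "(C', D') \<in> ratio C D"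
    then have *: "(A', B') \<in> fractions F" "(C', D') \<in> fractions F" "F dvd A * B' - A' * B" "F dvd C * D' - C' * D"
      by (auto simp: frac_class_iff)
    have "F dvd (A * B' - A' * B) * (C * D') + A' * B * (C * D' - C' * D)"
      by (rule dvd_add[OF dvd_mult2[OF *(3)] dvd_mult[OF *(4)]])
    also have "\<dots> = A * C * (B' * D') - A' * C' * (B * D)"
      by (simp add: algebra_simps)
    finally show "ratio (A' * C') (B' * D') = ratio (A * C) (B * D)"
      using frac_eq_iff fractions_mult fractions_add AB CD * by metis
  next
    show "(A, B) \<in> ratio A B" "(C, D) \<in> ratio C D"
      using AB CD by (simp_all add: frac_mem)
  qed
  then show ?thesis
    by (simp only: function_field_def monoid.select_convs)
qed

lemma frac_add:
  assumes AB: "(A, B) \<in> fractions F" and CD: "(C, D) \<in> fractions F"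
  shows "ratio A B \<oplus>\<^bsub>L\<^esub> ratio C D = ratio (A * D + C * B) (B * D)"
proof -
  have "(\<Union>(A, B)\<in>ratio A B. \<Union>(C, D)\<in>ratio C D. ratio (A * D + C * B) (B * D)) = ratio (A * D + C * B) (B * D)"
  proof (rule UN_UN_pair_constant)
    fix A' B' C' D' assume "(A', B') \<in> ratio A B" "(C', D') \<in> ratio C D"
    then have *: "(A', B') \<in> fractions F" "(C', D') \<in> fractions F" "F dvd A * B' - A' * B" "F dvd C * D' - C' * D"
      by (auto simp: frac_class_iff)
    have "F dvd (A * B' - A' * B) * (D * D') + (C * D' - C' * D) * (B * B')"
      by (rule dvd_add[OF dvd_mult2[OF *(3)] dvd_mult2[OF *(4)]])
    also have "\<dots> = (A * D + C * B) * (B' * D') - (A' * D' + C' * B') * (B * D)"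
      by (simp add: algebra_simps)
    finally show "ratio (A' * D' + C' * B') (B' * D') = ratio (A * D + C * B) (B * D)"
      using frac_eq_iff fractions_mult fractions_add AB CD * by metis
  next
    show "(A, B) \<in> ratio A B" "(C, D) \<in> ratio C D"
      using AB CD by (simp_all add: frac_mem)
  qed
  then show ?thesis
    by (simp only: function_field_def ring.select_convs)
qed

lemma frac_zero_fraction: "(0, 1) \<in> fractions F"
  using nonunit by (simp add: fractionsI[of 0])

lemma frac_zero: "\<zero>\<^bsub>L\<^esub> = ratio 0 1"
  by (simp add: function_field_def)

lemma frac_eq_zero_iff: "(A, B) \<in> fractions F \<Longrightarrow> ratio A B = \<zero>\<^bsub>L\<^esub> \<longleftrightarrow> F dvd A"
  using frac_eq_iff[OF _ frac_zero_fraction, of A B] unfolding frac_zero by simp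

end

section \<open>The Galois group as a group of bijections of the field\<close>

lemma subgroup_Gal:
  assumes "ring L" "K \<subseteq> carrier L"
  shows "subgroup {\<sigma> \<in> Bij (carrier L). \<sigma> \<in> ring_hom L L \<and> (\<forall>x\<in>K. \<sigma> x = x)} (BijGroup (carrier L))"
    (is "subgroup ?G _")
proof -
  interpret ring L by fact
  interpret B: group "BijGroup (carrier L)" by (rule group_BijGroup)
  show ?thesis
  proof (rule B.subgroupI)
    show "?G \<subseteq> carrier (BijGroup (carrier L))"
      by (auto simp: BijGroup_def)
    have "\<one>\<^bsub>BijGroup (carrier L)\<^esub> \<in> ?G"
      using B.one_closed assms(2) by (auto simp: BijGroup_def ring_hom_def)
    then show "?G \<noteq> {}" by blast
  next
    fix \<sigma> assume \<sigma>: "\<sigma> \<in> ?G"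
    then have bij: "bij_betw \<sigma> (carrier L) (carrier L)" and hom: "\<sigma> \<in> ring_hom L L"
      by (auto simp: Bij_def)
    let ?\<tau> = "restrict (inv_into (carrier L) \<sigma>) (carrier L)"
    have inv: "inv\<^bsub>BijGroup (carrier L)\<^esub> \<sigma> = ?\<tau>"
      using \<sigma> by (simp add: inv_BijGroup)
    have 1: "inv_into (carrier L) \<sigma> x \<in> carrier L" "\<sigma> (inv_into (carrier L) \<sigma> x) = x"
      if "x \<in> carrier L" for x
      using that bij by (auto simp: bij_betw_def inv_into_into f_inv_into_f)
    have 2: "inv_into (carrier L) \<sigma> (\<sigma> x) = x" if "x \<in> carrier L" for x
      using that bij by (auto simp: bij_betw_def)
    have "?\<tau> \<in> ring_hom L L"
    proof (rule ring_hom_memI)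
      fix x y assume xy: "x \<in> carrier L" "y \<in> carrier L"
      let ?a = "inv_into (carrier L) \<sigma> x" and ?b = "inv_into (carrier L) \<sigma> y"
      have "x \<otimes>\<^bsub>L\<^esub> y = \<sigma> (?a \<otimes>\<^bsub>L\<^esub> ?b)" "x \<oplus>\<^bsub>L\<^esub> y = \<sigma> (?a \<oplus>\<^bsub>L\<^esub> ?b)"
        using 1[OF xy(1)] 1[OF xy(2)] by (simp_all add: ring_hom_mult[OF hom] ring_hom_add[OF hom])
      then have "inv_into (carrier L) \<sigma> (x \<otimes>\<^bsub>L\<^esub> y) = ?a \<otimes>\<^bsub>L\<^esub> ?b"
        "inv_into (carrier L) \<sigma> (x \<oplus>\<^bsub>L\<^esub> y) = ?a \<oplus>\<^bsub>L\<^esub> ?b"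
        using 1[OF xy(1)] 1[OF xy(2)] by (simp_all only: 2 m_closed a_closed)
      then show "?\<tau> (x \<otimes>\<^bsub>L\<^esub> y) = ?\<tau> x \<otimes>\<^bsub>L\<^esub> ?\<tau> y" "?\<tau> (x \<oplus>\<^bsub>L\<^esub> y) = ?\<tau> x \<oplus>\<^bsub>L\<^esub> ?\<tau> y"
        using xy by simp_all
    next
      show "?\<tau> \<one>\<^bsub>L\<^esub> = \<one>\<^bsub>L\<^esub>"
        using 2[OF one_closed] ring_hom_one[OF hom] by simp
    qed (use 1 in auto)
    moreover have "?\<tau> x = x" if "x \<in> K" for x
      using 2[of x] that \<sigma> assms(2) by auto
    moreover have "?\<tau> \<in> Bij (carrier L)"
      using \<sigma> restrict_inv_into_Bij by blast
    ultimately show "inv\<^bsub>BijGroup (carrier L)\<^esub> \<sigma> \<in> ?G"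
      unfolding inv by blast
  next
    fix \<sigma> \<tau> assume *: "\<sigma> \<in> ?G" "\<tau> \<in> ?G"
    then have "compose (carrier L) \<sigma> \<tau> \<in> Bij (carrier L)"
      using compose_Bij by blast
    moreover have "compose (carrier L) \<sigma> \<tau> \<in> ring_hom L L"
      using * by (intro ring_hom_memI)
        (auto simp: compose_def ring_hom_closed[of _ L L] ring_hom_mult[of _ L L] ring_hom_add[of _ L L]
          ring_hom_one[of _ L L])
    ultimately show "\<sigma> \<otimes>\<^bsub>BijGroup (carrier L)\<^esub> \<tau> \<in> ?G"
      using * assms(2) by (auto simp: BijGroup_def compose_def)
  qed
qed

lemma group_Gal: "ring L \<Longrightarrow> K \<subseteq> carrier L \<Longrightarrow> group (Gal L K)"
  unfolding Gal_def by (rule subgroup.subgroup_is_group[OF subgroup_Gal group_BijGroup])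

lemma Gal_carrier:
  "\<sigma> \<in> carrier (Gal L K) \<longleftrightarrow> \<sigma> \<in> Bij (carrier L) \<and> \<sigma> \<in> ring_hom L L \<and> (\<forall>x\<in>K. \<sigma> x = x)"
  by (simp add: Gal_def)

lemma Gal_mult: "\<sigma> \<in> carrier (Gal L K) \<Longrightarrow> \<tau> \<in> carrier (Gal L K) \<Longrightarrow>
    \<sigma> \<otimes>\<^bsub>Gal L K\<^esub> \<tau> = compose (carrier L) \<sigma> \<tau>"
  by (simp add: Gal_def BijGroup_def)

lemma Gal_one: "\<one>\<^bsub>Gal L K\<^esub> = (\<lambda>x\<in>carrier L. x)"
  by (simp add: Gal_def BijGroup_def)

section \<open>Birational maps preserving the lines through a point\<close>

lemma linear_form_dvd_subst:
  fixes A :: "('n::finite, 'k::field) mpoly"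
  assumes "homogeneous 1 A" "\<And>i. G dvd \<Phi> i"
  shows "G dvd subst \<Phi> A"
proof -
  obtain c where "A = (\<Sum>i\<in>UNIV. const (c i) * coord i)"
    using linear_form[OF assms(1)] .
  then show ?thesis
    using assms(2) by (auto simp: subst.evaluate_sum subst.evaluate_mult intro!: dvd_sum)
qed

lemma linear_form_subst_translate:
  fixes A :: "('n::finite, 'k::field) mpoly"
  assumes "homogeneous 1 A"
  shows "subst (\<lambda>i. Q * coord i + const (p i) * R) A = Q * A + const (value_at p A) * R"
proof -
  obtain c where c: "A = (\<Sum>i\<in>UNIV. const (c i) * coord i)"
    using linear_form[OF assms(1)] .
  have const_sum: "const (\<Sum>i\<in>S. f i) = (\<Sum>i\<in>S. const (f i))" for f :: "'n \<Rightarrow> 'k" and S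
    by (induction S rule: infinite_finite_induct) (simp_all add: const_add)
  show ?thesis
    by (simp add: c subst.evaluate_sum subst.evaluate_mult value_at.evaluate_sum value_at.evaluate_mult
        const_sum const_mult sum_distrib_left sum_distrib_right distrib_left sum.distrib ac_simps)
qed

text \<open>For plane maps whose factor of proportionality is known explicitly; it cancels because
  the polynomial ring is a domain.\<close>

lemma same_map_0I:
  assumes "rational_map 0 \<Psi>" "s \<noteq> 0" "t \<noteq> 0" "\<And>i. \<Phi> i * s = t * \<Psi> i" "\<And>i. homogeneous d (\<Phi> i)"
  shows "same_map (0 :: ('n::{finite, linorder}, 'k::field) mpoly) \<Phi> \<Psi>"
proof -
  obtain i where "\<Psi> i \<noteq> 0"
    using assms(1) by (auto simp: rational_map_def)
  then have "\<Phi> i \<noteq> 0"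
    using assms(2-4) by (metis mult_eq_0_iff)
  then have "rational_map 0 \<Phi>"
    using assms(5) by (auto simp: rational_map_def)
  moreover have "\<Phi> i * \<Psi> j = \<Phi> j * \<Psi> i" for i j
  proof -
    have "s * (\<Phi> i * \<Psi> j) = (\<Phi> i * s) * \<Psi> j"
      by (simp add: ac_simps)
    also have "\<dots> = (\<Phi> j * s) * \<Psi> i"
      by (simp only: assms(4)) (simp add: ac_simps)
    also have "\<dots> = s * (\<Phi> j * \<Psi> i)"
      by (simp add: ac_simps)
    finally show ?thesis
      using assms(2) by simp
  qed
  ultimately show ?thesis
    using assms(1) by (simp add: same_map_def)
qed

lemma same_map_of_0:
  "same_map 0 \<Phi> \<Psi> \<Longrightarrow> rational_map F \<Phi> \<Longrightarrow> rational_map F \<Psi> \<Longrightarrow> same_map F \<Phi> \<Psi>"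
  by (simp add: same_map_def)

lemma automorphism_coord: "automorphism (coord :: 'n \<Rightarrow> ('n::{finite, linorder}, 'k::field) mpoly)"
proof -
  interpret plane: hypersurface "0 :: ('n, 'k) mpoly" by (rule hypersurface_0)
  have "\<forall>i. homogeneous (Suc 0) (coord i :: ('n, 'k) mpoly)" by simp
  then have "morphism (coord :: 'n \<Rightarrow> ('n, 'k) mpoly)"
    unfolding morphism_def by (intro conjI exI[of _ "Suc 0"]) auto
  moreover have "same_map 0 (coord :: 'n \<Rightarrow> ('n, 'k) mpoly) coord"
    using plane.self_map_coord by (simp add: self_map_def same_map_refl)
  ultimately show ?thesis
    unfolding automorphism_def by (metis comp_map_coord_left)
qed

text \<open>The forms that come from the projective line. Their fractions make up \<open>K\<close>,
  and the degree is recorded because numerator and denominator must share it.\<close>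

definition binary_form :: "(2 \<Rightarrow> (3, 'k::field) mpoly) \<Rightarrow> nat \<Rightarrow> (3, 'k) mpoly \<Rightarrow> bool"
  where "binary_form l e A \<longleftrightarrow> (\<exists>a. homogeneous e a \<and> A = subst l a)"

lemma binary_form_0 [simp]: "binary_form l e 0"
  unfolding binary_form_def by (rule exI[of _ 0]) simp

lemma binary_form_const: "binary_form l 0 (const c)"
  unfolding binary_form_def by (rule exI[of _ "const c"]) simp

lemma binary_form_l: "binary_form l 1 (l j)"
  unfolding binary_form_def by (rule exI[of _ "coord j"]) simp

lemma binary_form_add: "binary_form l e A \<Longrightarrow> binary_form l e B \<Longrightarrow> binary_form l e (A + B)"
  unfolding binary_form_def using homogeneous_add subst.evaluate_add by metis

lemma binary_form_uminus: "binary_form l e A \<Longrightarrow> binary_form l e (- A)"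
  unfolding binary_form_def using homogeneous_uminus subst_uminus by metis

lemma binary_form_diff: "binary_form l e A \<Longrightarrow> binary_form l e B \<Longrightarrow> binary_form l e (A - B)"
  using binary_form_add[of l e A "- B"] binary_form_uminus by auto

lemma binary_form_mult: "binary_form l e A \<Longrightarrow> binary_form l f B \<Longrightarrow> binary_form l (e + f) (A * B)"
  unfolding binary_form_def using homogeneous_mult subst.evaluate_mult by metis

text \<open>The forms \<open>l 0\<close>, \<open>l 1\<close>, \<open>m\<close> are linear
  coordinates of the plane in which \<open>p\<close> is the point with \<open>l 0 = l 1 = 0\<close>.
  Dividing by \<open>u\<close>, one of the two \<open>l j\<close>, gives the function
  \<open>y = m / u\<close> on the curve.\<close>

locale point_projection = hypersurface F for F :: "(3, 'k::field) mpoly" +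
  fixes l :: "2 \<Rightarrow> (3, 'k) mpoly" and p :: "3 \<Rightarrow> 'k" and m u :: "(3, 'k) mpoly"
  assumes field_L: "field (function_field F)"
    and l_linear: "homogeneous 1 (l j)" and l_p: "value_at p (l j) = 0"
    and m_linear: "homogeneous 1 m" and m_p: "value_at p m = 1"
    and u_l: "u \<in> range l" and u_not_dvd: "\<not> F dvd u"
    and coord_decomposition: "\<exists>g. binary_form l 1 g \<and> coord i = const (p i) * m + g"
begin

sublocale L: field L by (rule field_L)

abbreviation K where "K \<equiv> pencil_field F l"

lemma binary_form_homogeneous: "binary_form l e A \<Longrightarrow> homogeneous e A"
  unfolding binary_form_def using homogeneous_subst[OF _ l_linear] by auto

lemma u_linear: "homogeneous 1 u" and u_binary: "binary_form l 1 u"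
  using u_l l_linear binary_form_l by auto

lemma homogeneous_u_power: "homogeneous d (u ^ d)"
  using homogeneous_power[OF u_linear, of d] by simp

lemma fractions_u_power: "homogeneous d A \<Longrightarrow> (A, u ^ d) \<in> fractions F"
  by (rule fractionsI) (use homogeneous_u_power not_dvd_power[OF u_linear u_not_dvd] in auto)

lemma fractions_u: "homogeneous 1 A \<Longrightarrow> (A, u) \<in> fractions F"
  using fractions_u_power[of 1 A] by simp

lemma K_iff: "x \<in> K \<longleftrightarrow> (\<exists>e A B. binary_form l e A \<and> binary_form l e B \<and> \<not> F dvd B \<and> x = ratio A B)"
  unfolding pencil_field_def binary_form_def by blast

lemma binary_fraction:
  "binary_form l e A \<Longrightarrow> binary_form l e B \<Longrightarrow> \<not> F dvd B \<Longrightarrow> (A, B) \<in> fractions F"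
  by (intro fractionsI) (auto intro: binary_form_homogeneous)

lemma K_subset: "K \<subseteq> carrier L"
  using binary_fraction frac_closed by (auto simp: K_iff)

text \<open>Along each line through \<open>p\<close> the function \<open>m / u\<close> is an affine coordinate, and \<open>jonq n q\<close>
  is the map that preserves these lines and sends \<open>m / u\<close> to \<open>n / q\<close>.\<close>

definition jonq :: "(3, 'k) mpoly \<Rightarrow> (3, 'k) mpoly \<Rightarrow> 3 \<Rightarrow> (3, 'k) mpoly"
  where "jonq n q = (\<lambda>i. q * coord i + const (p i) * (u * n - q * m))"

text \<open>\<open>jonq n q\<close> scales a point by \<open>q\<close> and then moves it along
  \<open>p\<close>. A linear form vanishing at \<open>p\<close> is therefore only scaled, while
  \<open>m\<close> becomes \<open>q * m + (u * n - q * m)\<close>, which is the reason for the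
  choice of the shift.\<close>

lemma subst_jonq_linear:
  "homogeneous 1 A \<Longrightarrow> subst (jonq n q) A = q * A + const (value_at p A) * (u * n - q * m)"
  unfolding jonq_def by (rule linear_form_subst_translate)

lemma subst_jonq_l [simp]: "subst (jonq n q) (l j) = q * l j"
  by (simp add: subst_jonq_linear l_linear[simplified] l_p)

lemma subst_jonq_u [simp]: "subst (jonq n q) u = q * u"
proof -
  obtain j where j: "u = l j" using u_l by auto
  show ?thesis
    using subst_jonq_l[of n q j] by (simp only: j[symmetric])
qed

lemma subst_jonq_m [simp]: "subst (jonq n q) m = u * n"
  by (simp add: subst_jonq_linear m_linear[simplified] m_p)

lemma subst_jonq_binary:
  assumes "binary_form l e A"
  shows "subst (jonq n q) A = q ^ e * A"
proof -
  obtain a where a: "homogeneous e a" "A = subst l a"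
    using assms by (auto simp: binary_form_def)
  have "subst (jonq n q) A = subst (\<lambda>j. q * l j) a"
    by (simp add: a subst.evaluate_subst)
  then show ?thesis
    by (simp add: subst_scale[OF a(1)] a)
qed

text \<open>The transform \<open>(a y + b) / (c y + d)\<close> of \<open>y = m / u\<close> with
  denominators cleared. The encoding has no determinant condition; invertibility is supplied by the
  Galois group.\<close>

definition moebius :: "nat \<Rightarrow> (3, 'k) mpoly \<Rightarrow> (3, 'k) mpoly \<Rightarrow> bool"
  where "moebius e n q \<longleftrightarrow> (\<exists>a b c d. binary_form l e a \<and> binary_form l e b \<and> binary_form l e c \<and>
    binary_form l e d \<and> n = a * m + b * u \<and> q = c * m + d * u)"

lemma moebius_homogeneous:
  assumes "moebius e n q"
  shows "homogeneous (Suc e) n" "homogeneous (Suc e) q"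
  using assms homogeneous_mult[OF binary_form_homogeneous m_linear, of e]
    homogeneous_mult[OF binary_form_homogeneous u_linear, of e]
  by (auto simp: moebius_def intro!: homogeneous_add)

lemma jonq_homogeneous:
  assumes "moebius e n q"
  shows "homogeneous (Suc (Suc e)) (jonq n q i)"
proof -
  note nq = moebius_homogeneous[OF assms]
  have "homogeneous (Suc (Suc e)) (q * coord i)" "homogeneous (Suc (Suc e)) (u * n)" "homogeneous (Suc (Suc e)) (q * m)"
    using homogeneous_mult[OF nq(2) homogeneous_coord[of i]] homogeneous_mult[OF u_linear nq(1)]
      homogeneous_mult[OF nq(2) m_linear] by auto
  then show ?thesis
    using homogeneous_mult[OF homogeneous_const[of "p i"], of "Suc (Suc e)" "u * n - q * m"]
    by (auto simp: jonq_def intro: homogeneous_add homogeneous_diff)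
qed

text \<open>A common divisor of all components divides every linear form in them, in particular the
  pullback \<open>q * u\<close> of \<open>u\<close>.\<close>

lemma jonq_rational:
  assumes "moebius e n q" "\<not> G dvd q * u"
  shows "rational_map G (jonq n q)"
  unfolding rational_map_def
  using jonq_homogeneous[OF assms(1)] linear_form_dvd_subst[OF u_linear, of G "jonq n q"] assms(2)
  by auto

text \<open>Up to the common factor \<open>q'\<close>, which does not affect the rational map,
  composing two maps amounts to substituting the second into the fraction of the first.\<close>

lemma comp_jonq:
  "comp_map (jonq n q) (jonq n' q') i = q' * jonq (subst (jonq n' q') n) (subst (jonq n' q') q) i"
proof -
  let ?n = "subst (jonq n' q') n" and ?q = "subst (jonq n' q') q"
  have *: "Q * jonq n' q' i + const (p i) * (q' * u * N - Q * (u * n')) = q' * jonq N Q i" for N Q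
    unfolding jonq_def by (simp add: algebra_simps)
  have "comp_map (jonq n q) (jonq n' q') i
    = ?q * jonq n' q' i + const (p i) * (q' * u * ?n - ?q * (u * n'))"
    unfolding comp_map_def jonq_def[of n q]
    by (simp add: subst.evaluate_add subst.evaluate_mult subst_diff)
  also have "\<dots> = q' * jonq ?n ?q i"
    by (rule *)
  finally show ?thesis .
qed

lemma jonq_proportional: "n * q' = n' * q \<Longrightarrow> jonq n q i * q' = q * jonq n' q' i"
proof -
  assume "n * q' = n' * q"
  then have "const (p i) * u * (n * q') = const (p i) * u * (n' * q)" by simp
  then show ?thesis
    by (simp add: jonq_def algebra_simps)
qed

definition represents ::
    "(((3, 'k) mpoly \<times> (3, 'k) mpoly) set \<Rightarrow> ((3, 'k) mpoly \<times> (3, 'k) mpoly) set) \<Rightarrow>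
      (3, 'k) mpoly \<Rightarrow> (3, 'k) mpoly \<Rightarrow> bool"
  where "represents \<sigma> n q \<longleftrightarrow> (\<exists>e. moebius e n q) \<and> \<not> F dvd q \<and> \<sigma> (ratio m u) = ratio n q"

context
  fixes \<sigma> n q
  assumes \<sigma>: "\<sigma> \<in> carrier (Gal L K)" and represents: "represents \<sigma> n q"
begin

lemma \<sigma>_hom: "\<sigma> \<in> ring_hom L L"
  using \<sigma> by (simp add: Gal_carrier)

lemma \<sigma>_binary: "binary_form l e A \<Longrightarrow> binary_form l e B \<Longrightarrow> \<not> F dvd B \<Longrightarrow> \<sigma> (ratio A B) = ratio A B"
  using \<sigma> K_iff by (auto simp: Gal_carrier)

lemma \<sigma>_eq_zero_iff: "x \<in> carrier L \<Longrightarrow> \<sigma> x = \<zero>\<^bsub>L\<^esub> \<longleftrightarrow> x = \<zero>\<^bsub>L\<^esub>"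
proof -
  have "inj_on \<sigma> (carrier L)" "\<sigma> \<zero>\<^bsub>L\<^esub> = \<zero>\<^bsub>L\<^esub>"
    using \<sigma> ring_hom_zero[OF \<sigma>_hom L.ring_axioms L.ring_axioms]
    by (auto simp: Gal_carrier Bij_def bij_betw_def)
  then show "x \<in> carrier L \<Longrightarrow> ?thesis"
    using L.zero_closed by (metis inj_onD)
qed

lemma obtain_moebius: obtains e where "moebius e n q"
  using represents by (auto simp: represents_def)

lemma q_not_dvd: "\<not> F dvd q"
  using represents by (simp add: represents_def)

lemma q_homogeneous: "\<exists>e. homogeneous e q"
  using obtain_moebius moebius_homogeneous by metis

lemma qu_not_dvd: "\<not> F dvd q * u"
  using not_dvd_mult[OF _ u_linear q_not_dvd u_not_dvd] q_homogeneous by blast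

lemma fractions_jonq:
  assumes "homogeneous d A"
  shows "(subst (jonq n q) A, (q * u) ^ d) \<in> fractions F"
proof -
  obtain e where e: "moebius e n q" by (rule obtain_moebius)
  have qu: "homogeneous (Suc (Suc e)) (q * u)"
    using homogeneous_mult[OF moebius_homogeneous(2)[OF e] u_linear] by simp
  show ?thesis
    using homogeneous_subst[OF assms jonq_homogeneous[OF e]] homogeneous_power[OF qu]
      not_dvd_power[OF qu qu_not_dvd] by (rule fractionsI)
qed

text \<open>Each coordinate is \<open>p i * m\<close> plus a binary form \<open>g\<close>, so on the
  curve \<open>x_i / u = p_i y + g / u\<close>, where \<open>\<sigma>\<close> moves only
  \<open>y\<close>.\<close>

lemma \<sigma>_coord: "\<sigma> (ratio (coord i) u) = ratio (jonq n q i) (q * u)"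
proof -
  obtain e where e: "moebius e n q" by (rule obtain_moebius)
  obtain g where g: "binary_form l 1 g" "coord i = const (p i) * m + g"
    using coord_decomposition by blast
  have fg: "(g, u) \<in> fractions F" and fm: "(m, u) \<in> fractions F"
    using g m_linear binary_form_homogeneous by (auto intro!: fractions_u)
  have fx: "(coord i, u) \<in> fractions F"
    by (rule fractions_u) simp
  have fc: "(const (p i), 1) \<in> fractions F"
    using nonunit by (auto intro: fractionsI[of 0])
  have fnq: "(n, q) \<in> fractions F"
    using moebius_homogeneous[OF e] q_not_dvd by (rule fractionsI)
  have c: "\<sigma> (ratio (const (p i)) 1) = ratio (const (p i)) 1"
    using \<sigma>_binary[OF binary_form_const binary_form_const[of l 1] ] nonunit by simp
  have fcm: "(const (p i) * m, u) \<in> fractions F" and fcn: "(const (p i) * n, q) \<in> fractions F"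
    using fractions_mult[OF fc fm] fractions_mult[OF fc fnq] by simp_all
  have "ratio (coord i) u = ratio (const (p i)) 1 \<otimes>\<^bsub>L\<^esub> ratio m u \<oplus>\<^bsub>L\<^esub> ratio g u"
  proof -
    have "ratio (const (p i)) 1 \<otimes>\<^bsub>L\<^esub> ratio m u \<oplus>\<^bsub>L\<^esub> ratio g u
      = ratio (const (p i) * m * u + g * u) (u * u)"
      by (simp add: frac_mult[OF fc fm] frac_add[OF fcm fg])
    also have "\<dots> = ratio (coord i) u"
      using frac_eq_iff[OF fractions_add[OF fcm fg] fx] by (simp add: g(2) algebra_simps)
    finally show ?thesis by simp
  qed
  then have "\<sigma> (ratio (coord i) u) = ratio (const (p i)) 1 \<otimes>\<^bsub>L\<^esub> ratio n q \<oplus>\<^bsub>L\<^esub> ratio g u"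
    using frac_closed fc fm fg represents
    by (simp add: ring_hom_add[OF \<sigma>_hom] ring_hom_mult[OF \<sigma>_hom] c \<sigma>_binary[OF g(1) u_binary u_not_dvd]
        represents_def)
  also have "\<dots> = ratio (const (p i) * n * u + g * q) (q * u)"
    by (simp add: frac_mult[OF fc fnq] frac_add[OF fcn fg])
  also have "const (p i) * n * u + g * q = jonq n q i"
    unfolding jonq_def g(2) by (simp add: algebra_simps)
  finally show ?thesis .
qed

lemma \<sigma>_ratio_u_power:
  assumes "homogeneous d A"
  shows "\<sigma> (ratio A (u ^ d)) = ratio (subst (jonq n q) A) ((q * u) ^ d)"
  using assms
proof (induction d A rule: homogeneous_induct)
  case (zero d)
  have "ratio 0 (u ^ d) = \<zero>\<^bsub>L\<^esub>" "ratio 0 ((q * u) ^ d) = \<zero>\<^bsub>L\<^esub>"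
    using fractions_u_power[of d 0] fractions_jonq[of d 0] by (simp_all add: frac_eq_zero_iff)
  then show ?case
    using \<sigma>_eq_zero_iff[OF L.zero_closed] by simp
next
  case (const c)
  then show ?case
    using \<sigma>_binary[OF binary_form_const binary_form_const[of l 1]] nonunit by simp
next
  case (coord d A i)
  have "ratio (coord i) u \<otimes>\<^bsub>L\<^esub> ratio A (u ^ d) = ratio (coord i * A) (u ^ Suc d)"
    by (simp add: frac_mult fractions_u fractions_u_power coord)
  moreover have "ratio (coord i) u \<in> carrier L" "ratio A (u ^ d) \<in> carrier L"
    using coord by (simp_all add: frac_closed fractions_u fractions_u_power)
  ultimately have "\<sigma> (ratio (coord i * A) (u ^ Suc d))
    = ratio (jonq n q i) (q * u) \<otimes>\<^bsub>L\<^esub> ratio (subst (jonq n q) A) ((q * u) ^ d)"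
    using ring_hom_mult[OF \<sigma>_hom] coord(2) by (metis \<sigma>_coord)
  also have "\<dots> = ratio (subst (jonq n q) (coord i * A)) ((q * u) ^ Suc d)"
    using fractions_jonq[of 1 "coord i"] fractions_jonq[of d A] coord
    by (simp add: frac_mult subst.evaluate_mult)
  finally show ?case .
next
  case (add d A B)
  have *: "ratio A' C \<oplus>\<^bsub>L\<^esub> ratio B' C = ratio (A' + B') C"
    if "(A', C) \<in> fractions F" "(B', C) \<in> fractions F" "(A' + B', C) \<in> fractions F" for A' B' C
    using that fractions_add[OF that(1,2)]
    by (simp add: frac_add frac_eq_iff) (simp add: algebra_simps)
  have "ratio (A + B) (u ^ d) = ratio A (u ^ d) \<oplus>\<^bsub>L\<^esub> ratio B (u ^ d)"
    by (intro *[symmetric] fractions_u_power homogeneous_add add)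
  then have "\<sigma> (ratio (A + B) (u ^ d))
    = ratio (subst (jonq n q) A) ((q * u) ^ d) \<oplus>\<^bsub>L\<^esub> ratio (subst (jonq n q) B) ((q * u) ^ d)"
    using add by (simp add: ring_hom_add[OF \<sigma>_hom] frac_closed fractions_u_power)
  also have "\<dots> = ratio (subst (jonq n q) (A + B)) ((q * u) ^ d)"
    using *[OF fractions_jonq[OF add(1)] fractions_jonq[OF add(2)]]
      fractions_jonq[OF homogeneous_add[OF add(1,2)]] by (simp add: subst.evaluate_add)
  finally show ?case .
qed

text \<open>Injectivity of \<open>\<sigma>\<close>, read on fractions with denominator
  \<open>u ^ d\<close>. One direction shows that the map sends the curve into itself, the other that
  it is dominant there.\<close>

lemma jonq_dvd_iff:
  assumes "homogeneous d A"
  shows "F dvd subst (jonq n q) A \<longleftrightarrow> F dvd A"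
  using \<sigma>_eq_zero_iff[OF frac_closed[OF fractions_u_power[OF assms]]] \<sigma>_ratio_u_power[OF assms]
    frac_eq_zero_iff[OF fractions_u_power[OF assms]] frac_eq_zero_iff[OF fractions_jonq[OF assms]]
  by simp

lemma dominant_jonq: "dominant F (jonq n q)"
proof -
  obtain e where e: "moebius e n q" by (rule obtain_moebius)
  obtain d where "homogeneous d F"
    using homogeneous_F by blast
  then have "self_map F (jonq n q)"
    using jonq_rational[OF e qu_not_dvd] jonq_dvd_iff by (auto simp: self_map_def)
  then show ?thesis
    using jonq_dvd_iff by (auto simp: dominant_def)
qed

lemma fractions_subst_jonq:
  assumes "(A, B) \<in> fractions F"
  shows "(subst (jonq n q) A, subst (jonq n q) B) \<in> fractions F"
proof -
  obtain e where e: "moebius e n q" by (rule obtain_moebius)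
  obtain d where d: "homogeneous d A" "homogeneous d B" "\<not> F dvd B"
    using assms by (auto simp: fractions_iff)
  show ?thesis
    by (rule fractionsI[OF homogeneous_subst homogeneous_subst])
      (use d jonq_homogeneous[OF e] jonq_dvd_iff in auto)
qed

text \<open>\<open>A / B\<close> is the quotient of \<open>A / u ^ d\<close> by
  \<open>B / u ^ d\<close>, on which \<open>\<sigma>\<close> is already known.\<close>

lemma \<sigma>_ratio:
  assumes AB: "(A, B) \<in> fractions F"
  shows "\<sigma> (ratio A B) = ratio (subst (jonq n q) A) (subst (jonq n q) B)"
proof -
  let ?A = "subst (jonq n q) A" and ?B = "subst (jonq n q) B"
  obtain d where d: "homogeneous d A" "homogeneous d B" "\<not> F dvd B"
    using AB by (auto simp: fractions_iff)
  note AB' = fractions_subst_jonq[OF AB]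
  have *: "ratio A' B' \<otimes>\<^bsub>L\<^esub> ratio B' C' = ratio A' C'"
    if "(A', B') \<in> fractions F" "(B', C') \<in> fractions F" "(A', C') \<in> fractions F" for A' B' C'
    using that fractions_mult[OF that(1,2)] by (simp add: frac_mult frac_eq_iff algebra_simps)
  have "\<sigma> (ratio A B) \<otimes>\<^bsub>L\<^esub> \<sigma> (ratio B (u ^ d)) = \<sigma> (ratio A (u ^ d))"
    using *[OF AB fractions_u_power[OF d(2)] fractions_u_power[OF d(1)]]
    by (metis AB d(2) fractions_u_power frac_closed ring_hom_mult[OF \<sigma>_hom])
  moreover have "ratio ?A ?B \<otimes>\<^bsub>L\<^esub> \<sigma> (ratio B (u ^ d)) = \<sigma> (ratio A (u ^ d))"
    using *[OF AB' fractions_jonq[OF d(2)] fractions_jonq[OF d(1)]] d by (simp add: \<sigma>_ratio_u_power)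
  moreover have "\<sigma> (ratio B (u ^ d)) \<noteq> \<zero>\<^bsub>L\<^esub>"
    using d fractions_u_power[OF d(2)] by (simp add: \<sigma>_eq_zero_iff frac_closed frac_eq_zero_iff)
  moreover have "\<sigma> (ratio A B) \<in> carrier L" "\<sigma> (ratio B (u ^ d)) \<in> carrier L" "ratio ?A ?B \<in> carrier L"
    using ring_hom_closed[OF \<sigma>_hom] frac_closed AB AB' fractions_u_power[OF d(2)] by auto
  ultimately show ?thesis
    using L.m_rcancel by metis
qed

lemma pullback_jonq: "pullback F (map_class F (jonq n q)) = \<sigma>"
proof
  fix f
  show "pullback F (map_class F (jonq n q)) f = \<sigma> f"
  proof (cases "f \<in> carrier L")
    \<comment> \<open>Outside the field both maps are \<open>undefined\<close>.\<close>
    case False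
    then show ?thesis
      using \<sigma> by (auto simp: pullback_def Gal_carrier Bij_def extensional_def)
  next
    case True
    then obtain A0 B0 where AB0: "(A0, B0) \<in> fractions F" "f = ratio A0 B0"
      by (rule function_field_cases)
    let ?J = "jonq n q"
    have "(\<Union>\<Phi>\<in>map_class F ?J. \<Union>y\<in>f. (\<lambda>(A, B). ratio (subst \<Phi> A) (subst \<Phi> B)) y) = \<sigma> f"
    proof (rule UN_UN_constant)
      fix \<Phi> y assume \<Phi>: "\<Phi> \<in> map_class F ?J" and y: "y \<in> f"
      obtain A B where [simp]: "y = (A, B)" by (cases y)
      have AB: "(A, B) \<in> fractions F" "f = ratio A B"
        using y AB0 by (simp_all add: frac_mem)
      then obtain d where d: "homogeneous d A" "homogeneous d B" "\<not> F dvd B"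
        by (auto simp: fractions_iff)
      have same: "same_map F ?J \<Phi>"
        using \<Phi> by (simp add: map_class_def)
      obtain e' where e': "\<And>i. homogeneous e' (\<Phi> i)"
        using same_map_rational(2)[OF same] by (auto simp: rational_map_def)
      have "\<not> F dvd subst \<Phi> B"
        using dominant_dvd_iff[OF dominant_same[OF same dominant_jonq] d(2)] d(3) by simp
      then have \<Phi>AB: "(subst \<Phi> A, subst \<Phi> B) \<in> fractions F"
        by (rule fractionsI[OF homogeneous_subst[OF d(1) e'] homogeneous_subst[OF d(2) e']])
      have "F dvd subst ?J A * subst \<Phi> B - subst ?J B * subst \<Phi> A"
        by (rule same_map_subst_cross[OF same d(1,2)])
      then have "ratio (subst ?J A) (subst ?J B) = ratio (subst \<Phi> A) (subst \<Phi> B)"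
        using frac_eq_iff[OF fractions_subst_jonq[OF AB(1)] \<Phi>AB] by (simp add: mult.commute)
      then show "(\<lambda>(A, B). ratio (subst \<Phi> A) (subst \<Phi> B)) y = \<sigma> f"
        using AB \<sigma>_ratio by simp
    next
      show "?J \<in> map_class F ?J"
        using dominant_jonq by (simp add: map_class_def same_map_refl dominant_def self_map_def)
      show "(A0, B0) \<in> f"
        using AB0 by (simp add: frac_mem)
    qed
    then show ?thesis
      using True by (simp only: pullback_def restrict_apply' split_def)
  qed
qed

end


section \<open>From representatives of the Galois elements to a group of plane maps\<close>

lemma group_Gal_L: "group (Gal L K)"
  using group_Gal[OF L.ring_axioms K_subset] .

text \<open>\<open>\<sigma> \<mapsto> [jonq (N \<sigma>) (Q \<sigma>)]\<close> reverses products, as pullback does. In the last two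
  assumptions the compatibility with products and units is required of polynomials, not only of
  functions on the curve.\<close>

lemma extends_to_subgroupI:
  fixes N Q
  defines "J \<equiv> \<lambda>\<sigma>. jonq (N \<sigma>) (Q \<sigma>)"
  assumes represents: "\<And>\<sigma>. \<sigma> \<in> carrier (Gal L K) \<Longrightarrow> represents \<sigma> (N \<sigma>) (Q \<sigma>)"
    and mult: "\<And>\<sigma> \<tau>. \<sigma> \<in> carrier (Gal L K) \<Longrightarrow> \<tau> \<in> carrier (Gal L K) \<Longrightarrow>
      subst (J \<tau>) (N \<sigma>) * Q (\<tau> \<otimes>\<^bsub>Gal L K\<^esub> \<sigma>) = N (\<tau> \<otimes>\<^bsub>Gal L K\<^esub> \<sigma>) * subst (J \<tau>) (Q \<sigma>)"
    and one: "N \<one>\<^bsub>Gal L K\<^esub> * u = Q \<one>\<^bsub>Gal L K\<^esub> * m"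
  shows "extends_to_subgroup F l (Jonq l)"
proof -
  interpret plane: hypersurface "0 :: (3, 'k) mpoly" by (rule hypersurface_0)
  interpret G: group "Gal L K" by (rule group_Gal_L)
  let ?G = "carrier (Gal L K)"
  have u0: "u \<noteq> 0"
    using u_not_dvd by auto
  have Q0: "Q \<sigma> \<noteq> 0" if "\<sigma> \<in> ?G" for \<sigma>
    using represents[OF that] by (auto simp: represents_def)
  have J_homogeneous: "\<exists>d. \<forall>i. homogeneous d (J \<sigma> i)" if "\<sigma> \<in> ?G" for \<sigma>
    using represents[OF that] jonq_homogeneous unfolding represents_def J_def by blast
  have J_rational: "rational_map 0 (J \<sigma>)" if "\<sigma> \<in> ?G" for \<sigma>
    using represents[OF that] jonq_rational[of _ "N \<sigma>" "Q \<sigma>" 0] Q0[OF that] u0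
    unfolding represents_def J_def by auto
  have J_F: "dominant F (J \<sigma>)" "rational_map F (J \<sigma>)" if "\<sigma> \<in> ?G" for \<sigma>
    using dominant_jonq[OF that represents[OF that]] by (auto simp: J_def dominant_def self_map_def)
  have comp: "same_map 0 (comp_map (J \<sigma>) (J \<tau>)) (J (\<tau> \<otimes>\<^bsub>Gal L K\<^esub> \<sigma>))"
    if \<sigma>: "\<sigma> \<in> ?G" and \<tau>: "\<tau> \<in> ?G" for \<sigma> \<tau>
  proof -
    let ?\<rho> = "\<tau> \<otimes>\<^bsub>Gal L K\<^esub> \<sigma>"
    have \<rho>: "?\<rho> \<in> ?G"
      using \<sigma> \<tau> by simp
    let ?n = "subst (J \<tau>) (N \<sigma>)" and ?q = "subst (J \<tau>) (Q \<sigma>)"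
    obtain e where "moebius e (N \<sigma>) (Q \<sigma>)"
      using represents[OF \<sigma>] by (auto simp: represents_def)
    \<comment> \<open>Dominance on the curve shows that the substituted denominator is nonzero
      there, hence nonzero as a polynomial and available as a factor.\<close>
    then have "\<not> F dvd ?q"
      using dominant_dvd_iff[OF J_F(1)[OF \<tau>] moebius_homogeneous(2)] represents[OF \<sigma>]
      by (auto simp: represents_def)
    then have q0: "?q \<noteq> 0" by auto
    obtain d d' where d: "\<And>i. homogeneous d (J \<sigma> i)" "\<And>i. homogeneous d' (J \<tau> i)"
      using J_homogeneous[OF \<sigma>] J_homogeneous[OF \<tau>] by blast
    show ?thesis
    proof (rule same_map_0I[where s = "Q ?\<rho>" and t = "Q \<tau> * ?q"])
      show "comp_map (J \<sigma>) (J \<tau>) i * Q ?\<rho> = Q \<tau> * ?q * J ?\<rho> i" for i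
        using jonq_proportional[OF mult[OF \<sigma> \<tau>], of i]
        unfolding J_def by (simp add: comp_jonq mult.assoc)
      show "homogeneous (d * d') (comp_map (J \<sigma>) (J \<tau>) i)" for i
        unfolding comp_map_def by (rule homogeneous_subst[OF d])
    qed (use J_rational[OF \<rho>] Q0 \<rho> \<tau> q0 in auto)
  qed
  have unit: "same_map 0 (J \<one>\<^bsub>Gal L K\<^esub>) coord"
  proof -
    obtain d where d: "\<And>i. homogeneous d (J \<one>\<^bsub>Gal L K\<^esub> i)"
      using J_homogeneous[OF G.one_closed] by blast
    have "J \<one>\<^bsub>Gal L K\<^esub> i * 1 = Q \<one>\<^bsub>Gal L K\<^esub> * coord i" for i
      using one by (simp add: J_def jonq_def mult.commute)
    then show ?thesis
      using plane.self_map_coord Q0 d by (intro same_map_0I[where s = 1]) (auto simp: self_map_def)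
  qed
  \<comment> \<open>The inverse of the plane map is the map attached to the inverse automorphism,
    since composition and unit hold in the whole plane.\<close>
  have cancel: "same_map 0 (comp_map (J \<sigma>) (J (inv\<^bsub>Gal L K\<^esub> \<sigma>))) coord"
    "same_map 0 (comp_map (J (inv\<^bsub>Gal L K\<^esub> \<sigma>)) (J \<sigma>)) coord" if "\<sigma> \<in> ?G" for \<sigma>
  proof -
    have "same_map 0 (comp_map (J \<sigma>) (J (inv\<^bsub>Gal L K\<^esub> \<sigma>))) (J \<one>\<^bsub>Gal L K\<^esub>)"
      "same_map 0 (comp_map (J (inv\<^bsub>Gal L K\<^esub> \<sigma>)) (J \<sigma>)) (J \<one>\<^bsub>Gal L K\<^esub>)"
      using comp[OF that G.inv_closed[OF that]] comp[OF G.inv_closed[OF that] that] that by simp_all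
    then show "same_map 0 (comp_map (J \<sigma>) (J (inv\<^bsub>Gal L K\<^esub> \<sigma>))) coord"
      "same_map 0 (comp_map (J (inv\<^bsub>Gal L K\<^esub> \<sigma>)) (J \<sigma>)) coord"
      using plane.same_map_trans[OF _ unit] by blast+
  qed
  have J_birational: "birational 0 (J \<sigma>)" if "\<sigma> \<in> ?G" for \<sigma>
    unfolding birational_def self_map_def
    using J_rational[OF that] J_rational[OF G.inv_closed[OF that]] cancel[OF that] by auto
  have self_F: "self_map F (J \<sigma>)" if "\<sigma> \<in> ?G" for \<sigma>
    using J_F[OF that] by (simp add: dominant_def)
  \<comment> \<open>Identities of plane maps restrict to the curve as soon as both sides are defined
    on it, which dominance ensures for the composites.\<close>
  have cancel_F: "same_map F (comp_map (J \<sigma>) (J (inv\<^bsub>Gal L K\<^esub> \<sigma>))) coord"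
    "same_map F (comp_map (J (inv\<^bsub>Gal L K\<^esub> \<sigma>)) (J \<sigma>)) coord" if "\<sigma> \<in> ?G" for \<sigma>
    using same_map_of_0[OF cancel(1)[OF that]] same_map_of_0[OF cancel(2)[OF that]] self_map_coord
      rational_map_comp[OF J_F(2)[OF that] J_F(1)[OF G.inv_closed[OF that]]]
      rational_map_comp[OF J_F(2)[OF G.inv_closed[OF that]] J_F(1)[OF that]]
    by (simp_all add: self_map_def)
  have J_birational_F: "birational F (J \<sigma>)" if "\<sigma> \<in> ?G" for \<sigma>
    unfolding birational_def
    using self_F[OF that] self_F[OF G.inv_closed[OF that]] cancel_F[OF that] by blast

  define E where "E = (\<lambda>\<sigma>. map_class 0 (J \<sigma>))"
  define H where "H = E ` ?G"
  interpret P: group "Bir_P2 :: (3 \<Rightarrow> (3, 'k) mpoly) set monoid"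
    by (rule plane.group_Bir)
  have E_closed: "E \<sigma> \<in> carrier Bir_P2" if "\<sigma> \<in> ?G" for \<sigma>
    unfolding E_def plane.Bir_carrier using J_birational[OF that] by blast
  have E_mult: "E \<sigma> \<otimes>\<^bsub>Bir_P2\<^esub> E \<tau> = E (\<tau> \<otimes>\<^bsub>Gal L K\<^esub> \<sigma>)" if "\<sigma> \<in> ?G" "\<tau> \<in> ?G" for \<sigma> \<tau>
    unfolding E_def using plane.Bir_mult J_birational that plane.map_class_eq[OF comp] by simp
  have E_inv: "inv\<^bsub>Bir_P2\<^esub> (E \<sigma>) = E (inv\<^bsub>Gal L K\<^esub> \<sigma>)" if "\<sigma> \<in> ?G" for \<sigma>
    unfolding E_def using plane.Bir_inv J_birational that cancel by simp
  have "subgroup H Bir_P2"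
  proof (rule P.subgroupI)
    show "H \<subseteq> carrier Bir_P2"
      using E_closed by (auto simp: H_def)
    show "H \<noteq> {}"
      using G.one_closed by (auto simp: H_def)
  qed (use E_mult E_inv in \<open>auto simp: H_def\<close>)
  moreover have "H \<subseteq> Jonq l"
  proof
    fix \<phi> assume "\<phi> \<in> H"
    then obtain \<sigma> where \<sigma>: "\<sigma> \<in> ?G" "\<phi> = E \<sigma>"
      by (auto simp: H_def)
    obtain d where d: "\<And>i. homogeneous d (J \<sigma> i)"
      using J_homogeneous[OF \<sigma>(1)] by blast
    obtain j where "l j \<noteq> 0"
      using u_l u0 by auto
    then have l: "rational_map 0 l"
      using l_linear by (auto simp: rational_map_def)
    \<comment> \<open>Every line through \<open>p\<close> is mapped to itself, so the automorphism
      of the projective line is the identity.\<close>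
    have "same_map 0 (comp_map l (J \<sigma>)) l"
    proof (rule same_map_0I[where s = 1 and t = "Q \<sigma>"])
      show "homogeneous (1 * d) (comp_map l (J \<sigma>) j)" for j
        unfolding comp_map_def by (rule homogeneous_subst[OF l_linear d])
    qed (use l Q0 \<sigma> in \<open>auto simp: comp_map_def J_def\<close>)
    then have "same_map 0 (comp_map l \<Phi>) (comp_map coord l)" if "\<Phi> \<in> \<phi>" for \<Phi>
      using plane.same_map_trans[OF plane.same_map_comp_right[OF same_map_sym _ l]]
        plane.birational_dominant plane.birational_same J_birational[OF \<sigma>(1)] that
      by (auto simp: \<sigma>(2) E_def map_class_def)
    then show "\<phi> \<in> Jonq l"
      using automorphism_coord E_closed[OF \<sigma>(1)] \<sigma>(2) unfolding Jonq_def by blast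
  qed
  moreover have restrict: "restrict_to F (E \<sigma>) = map_class F (J \<sigma>)" if "\<sigma> \<in> ?G" for \<sigma>
  proof -
    \<comment> \<open>Representatives that vanish on the curve have an empty class there; all others
      agree on it with \<open>J \<sigma>\<close>.\<close>
    have "map_class F \<Phi> \<subseteq> map_class F (J \<sigma>)" if \<Phi>: "\<Phi> \<in> map_class 0 (J \<sigma>)" for \<Phi>
    proof (cases "rational_map F \<Phi>")
      case True
      then have "same_map F (J \<sigma>) \<Phi>"
        using \<Phi> J_F(2)[OF \<open>\<sigma> \<in> ?G\<close>] by (auto simp: map_class_def intro: same_map_of_0)
      then show ?thesis
        using map_class_eq by blast
    qed (auto simp: map_class_def same_map_def)
    moreover have "J \<sigma> \<in> map_class 0 (J \<sigma>)"
      using J_rational[OF that] by (simp add: map_class_def same_map_refl)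
    ultimately show ?thesis
      unfolding restrict_to_def E_def by blast
  qed
  moreover have "\<forall>\<phi>\<in>H. preserves F \<phi>"
  proof
    fix \<phi> assume "\<phi> \<in> H"
    then obtain \<sigma> where "\<sigma> \<in> ?G" "\<phi> = E \<sigma>"
      by (auto simp: H_def)
    then show "preserves F \<phi>"
      using restrict J_birational_F Bir_carrier unfolding preserves_def by metis
  qed
  moreover have "(\<lambda>\<phi>. field_aut F (restrict_to F \<phi>)) \<in> iso (Bir_P2\<lparr>carrier := H\<rparr>) (Gal L K)"
  proof -
    let ?f = "\<lambda>\<phi>. field_aut F (restrict_to F \<phi>)"
    \<comment> \<open>\<open>E\<close> reverses products, and \<open>field_aut\<close> pulls back
      along the inverse; so \<open>E \<sigma>\<close> goes to the inverse of
      \<open>\<sigma>\<close>, and the two reversals cancel.\<close>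
    have f: "?f (E \<sigma>) = inv\<^bsub>Gal L K\<^esub> \<sigma>" if "\<sigma> \<in> ?G" for \<sigma>
    proof -
      have "inv\<^bsub>Bir F\<^esub> (map_class F (J \<sigma>)) = map_class F (J (inv\<^bsub>Gal L K\<^esub> \<sigma>))"
        using Bir_inv J_birational_F cancel_F that by simp
      then show ?thesis
        using pullback_jonq[OF G.inv_closed[OF that] represents] that
        by (simp add: field_aut_def restrict J_def)
    qed
    have "?f \<in> hom (Bir_P2\<lparr>carrier := H\<rparr>) (Gal L K)"
      by (rule homI) (auto simp: H_def E_mult f G.inv_mult_group)
    moreover have "bij_betw ?f H ?G"
    proof (rule bij_betw_imageI)
      \<comment> \<open>Although \<open>?f\<close> sees only the curve, its value determines
        \<open>\<sigma>\<close> and thereby the plane map \<open>E \<sigma>\<close>.\<close>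
      show "inj_on ?f H"
      proof (rule inj_onI)
        fix x y assume "x \<in> H" "y \<in> H" "?f x = ?f y"
        moreover obtain \<sigma> \<tau> where "\<sigma> \<in> ?G" "x = E \<sigma>" "\<tau> \<in> ?G" "y = E \<tau>"
          using calculation(1,2) by (auto simp: H_def)
        ultimately show "x = y"
          using f G.inv_inv by metis
      qed
      show "?f ` H = ?G"
      proof (intro equalityI subsetI)
        fix \<sigma> assume "\<sigma> \<in> ?G"
        then have "\<sigma> = ?f (E (inv\<^bsub>Gal L K\<^esub> \<sigma>))" "E (inv\<^bsub>Gal L K\<^esub> \<sigma>) \<in> H"
          by (simp_all add: f H_def)
        then show "\<sigma> \<in> ?f ` H" by blast
      qed (auto simp: H_def f)
    qed
    ultimately show ?thesis
      by (simp add: iso_def)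
  qed
  ultimately show ?thesis
    unfolding extends_to_subgroup_def by blast
qed

end

section \<open>Linear relations with coefficients in the pencil field\<close>

lemma constant_poly_hom:
  "evaluate (\<lambda>c. [:const c:]) (\<lambda>j. [:w j:]) A = [:subst w A :: ('n::finite, 'k::field) mpoly:]"
proof -
  interpret h: coefficient_hom "\<lambda>c::'k. [:const c :: ('n, 'k) mpoly:]"
    by unfold_locales (simp_all add: const_add const_mult one_pCons)
  have 1: "[:a:] ^ k = [:a ^ k:]" for a :: "('n, 'k) mpoly" and k
    by (induction k) (simp_all add: one_pCons mult.commute)
  have 2: "(\<Prod>i\<in>S. [:f i:]) = [:\<Prod>i\<in>S. f i:]" for S and f :: "'b \<Rightarrow> ('n, 'k) mpoly"
    by (induction S rule: infinite_finite_induct) (simp_all add: one_pCons mult.commute)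
  show ?thesis
    by (induction A rule: poly_mapping_induct)
      (simp_all add: h.evaluate_add subst.evaluate_add h.evaluate_single subst.evaluate_single
        monomial_value_def 1 2)
qed

text \<open>Translation by \<open>z\<close> in the direction \<open>p\<close>, as a polynomial in \<open>z\<close>.\<close>

definition translate :: "('n::finite \<Rightarrow> 'k::field) \<Rightarrow> ('n, 'k) mpoly \<Rightarrow> ('n, 'k) mpoly poly"
  where "translate p = evaluate (\<lambda>c. [:const c:]) (\<lambda>i. [:coord i, const (p i):])"

interpretation translate: coefficient_hom "\<lambda>c::'k::field. [:const c :: ('n::finite, 'k) mpoly:]"
  by unfold_locales (simp_all add: const_add const_mult one_pCons)

lemma translate_mult: "translate p (A * B) = translate p A * translate p B"
  and translate_add: "translate p (A + B) = translate p A + translate p B"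
  by (simp_all add: translate_def translate.evaluate_mult translate.evaluate_add)

lemma translate_power: "translate p (A ^ n) = translate p A ^ n"
  by (simp add: translate_def translate.evaluate_power)

lemma translate_linear:
  assumes "homogeneous 1 A"
  shows "translate p A = [:A, const (value_at p A):]"
proof -
  obtain c where c: "A = (\<Sum>i\<in>UNIV. const (c i) * coord i)"
    using linear_form[OF assms] .
  have sum: "(\<Sum>i\<in>S. [:f i, const (g i):]) = [:\<Sum>i\<in>S. f i, const (\<Sum>i\<in>S. g i):]"
    for S and f :: "'a \<Rightarrow> ('a, 'b) mpoly" and g
    by (induction S rule: infinite_finite_induct) (simp_all add: const_add)
  show ?thesis
    by (simp add: c translate_def translate.evaluate_sum translate.evaluate_mult
        value_at.evaluate_sum value_at.evaluate_mult flip: const_mult sum)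
      (simp add: mult.commute)
qed

lemma poly_translate_0: "poly (translate p A) 0 = A"
proof -
  have 1: "poly (translate p (Poly_Mapping.single m c)) 0 = Poly_Mapping.single m c" for m c
  proof -
    have "poly (translate p (Poly_Mapping.single m c)) 0 = subst coord (Poly_Mapping.single m c)"
      unfolding translate_def translate.evaluate_single subst.evaluate_single
      by (simp add: monomial_value_def poly_prod)
    then show ?thesis by simp
  qed
  show ?thesis
    by (induction A rule: poly_mapping_induct) (simp_all add: 1 translate_add, simp add: translate_def)
qed

context point_projection
begin

text \<open>\<open>l 0\<close> and \<open>l 1\<close> vanish at \<open>p\<close> and hence do not
  change under translation along \<open>p\<close>.\<close>

lemma translate_binary: "binary_form l e A \<Longrightarrow> translate p A = [:A:]"
proof -
  assume "binary_form l e A"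
  then obtain a where a: "A = subst l a"
    by (auto simp: binary_form_def)
  have "translate p (l j) = [:l j:]" for j
    using l_p by (simp add: translate_linear[OF l_linear])
  then have "translate p A = evaluate (\<lambda>c. [:const c:]) (\<lambda>j. [:l j:]) a"
    unfolding a translate_def by (simp add: translate.evaluate_subst)
  then show ?thesis
    by (simp add: constant_poly_hom a)
qed

lemma ratio_cancel:
  assumes "(A, B) \<in> fractions F" "homogeneous c C" "\<not> F dvd C"
  shows "ratio (A * C) (B * C) = ratio A B"
proof -
  have "(A * C, B * C) \<in> fractions F"
    using fractions_mult[OF assms(1) fractionsI[OF assms(2,2,3)]] .
  then show ?thesis
    using frac_eq_iff[OF _ assms(1)] by (simp add: algebra_simps)
qed

text \<open>A common denominator forces the numerators to have one degree, so that a relation over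
  \<open>K\<close> becomes a relation between forms.\<close>

lemma common_denominator:
  fixes f :: "nat \<Rightarrow> ((3, 'k) mpoly \<times> (3, 'k) mpoly) set"
  assumes "\<And>i. i < n \<Longrightarrow> f i \<in> K"
  shows "\<exists>e a b. binary_form l e b \<and> \<not> F dvd b \<and>
    (\<forall>i<n. binary_form l e (a i) \<and> f i = ratio (a i) b)"
  using assms
proof (induction n)
  case 0
  have "binary_form l 0 1"
    using binary_form_const[of l 1] by simp
  with nonunit show ?case by blast
next
  case (Suc n)
  from Suc.IH[OF Suc.prems[OF less_SucI]] obtain e a b where IH: "binary_form l e b" "\<not> F dvd b"
    "\<forall>i<n. binary_form l e (a i) \<and> f i = ratio (a i) b"
    by blast
  obtain e' A B where AB: "binary_form l e' A" "binary_form l e' B" "\<not> F dvd B" "f n = ratio A B"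
    using Suc.prems[of n] by (auto simp: K_iff)
  note hom = binary_form_homogeneous[OF IH(1)] binary_form_homogeneous[OF AB(2)]
  define a' where "a' = (\<lambda>i. if i < n then a i * B else b * A)"
  have "binary_form l (e + e') (a' i) \<and> f i = ratio (a' i) (b * B)" if "i < Suc n" for i
  proof (cases "i < n")
    case True
    then show ?thesis
      using IH(3) binary_form_mult[OF _ AB(2)] ratio_cancel[OF binary_fraction[OF _ IH(1,2)] hom(2) AB(3)]
      by (simp add: a'_def)
  next
    case False
    then have "i = n"
      using that by simp
    then show ?thesis
      using binary_form_mult[OF IH(1) AB(1)] ratio_cancel[OF binary_fraction[OF AB(1-3)] hom(1) IH(2)] AB(4)
      by (simp add: a'_def mult.commute)
  qed
  moreover have "binary_form l (e + e') (b * B)" "\<not> F dvd b * B"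
    using binary_form_mult[OF IH(1) AB(2)] not_dvd_mult[OF hom IH(2) AB(3)] by auto
  ultimately show ?case by blast
qed

lemma combine_ratio:
  assumes "binary_form l e b" "\<not> F dvd b" "homogeneous d v" "\<not> F dvd v"
    and "\<And>i. i \<in> set is \<Longrightarrow> binary_form l e (a i) \<and> homogeneous d (c i)"
  shows "L.combine (map (\<lambda>i. ratio (a i) b) is) (map (\<lambda>i. ratio (c i) v) is)
      = ratio (\<Sum>i\<leftarrow>is. a i * c i) (b * v)
    \<and> homogeneous (e + d) (\<Sum>i\<leftarrow>is. a i * c i)"
  using assms(5)
proof (induction "is")
  case Nil
  note b = binary_form_homogeneous[OF assms(1)]
  have "(0, b * v) \<in> fractions F"
    using fractionsI[OF homogeneous_0 homogeneous_mult[OF b assms(3)]]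
      not_dvd_mult[OF b assms(3) assms(2,4)] by blast
  then show ?case
    using frac_eq_zero_iff[of 0 "b * v"] by simp
next
  case (Cons i "is")
  note b = binary_form_homogeneous[OF assms(1)]
  have i: "binary_form l e (a i)" "homogeneous d (c i)"
    using Cons.prems by auto
  let ?S = "\<Sum>i\<leftarrow>is. a i * c i"
  have IH: "homogeneous (e + d) ?S"
    "L.combine (map (\<lambda>i. ratio (a i) b) is) (map (\<lambda>i. ratio (c i) v) is) = ratio ?S (b * v)"
    using Cons by auto
  have bv: "homogeneous (e + d) (b * v)" "\<not> F dvd b * v"
    using homogeneous_mult[OF b assms(3)] not_dvd_mult[OF b assms(3) assms(2,4)] by auto
  have ac: "homogeneous (e + d) (a i * c i)"
    using homogeneous_mult[OF binary_form_homogeneous[OF i(1)] i(2)] .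
  have f: "(a i, b) \<in> fractions F" "(c i, v) \<in> fractions F"
    "(a i * c i, b * v) \<in> fractions F" "(?S, b * v) \<in> fractions F" "(a i * c i + ?S, b * v) \<in> fractions F"
    using binary_fraction[OF i(1) assms(1,2)] fractionsI[OF i(2) assms(3,4)] fractionsI[OF ac bv]
      fractionsI[OF IH(1) bv] fractionsI[OF homogeneous_add[OF ac IH(1)] bv] by auto
  have "ratio (a i) b \<otimes>\<^bsub>L\<^esub> ratio (c i) v \<oplus>\<^bsub>L\<^esub> ratio ?S (b * v)
    = ratio (a i * c i * (b * v) + ?S * (b * v)) (b * v * (b * v))"
    by (simp only: frac_mult[OF f(1,2)] frac_add[OF f(3,4)])
  also have "\<dots> = ratio (a i * c i + ?S) (b * v)"
    using ratio_cancel[OF f(5) bv] by (simp only: distrib_right)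
  finally show ?case
    using IH homogeneous_add[OF ac IH(1)] by simp
qed

text \<open>More than \<open>n\<close> elements \<open>c i / v\<close> of the function field are
  dependent over \<open>K\<close>; clearing denominators gives the relation. A coefficient is
  nonzero in \<open>K\<close> exactly if \<open>F\<close> does not divide its numerator.\<close>

lemma dependent_forms:
  assumes dim: "L.dimension n K (carrier L)" "n < k" and K: "subfield K L"
    and v: "homogeneous d v" "\<not> F dvd v" and c: "\<And>i. i < k \<Longrightarrow> homogeneous d (c i)"
  shows "\<exists>e a. (\<forall>i<k. binary_form l e (a i)) \<and> (\<exists>i<k. \<not> F dvd a i) \<and> F dvd (\<Sum>i<k. a i * c i)"
proof -
  define Us where "Us = map (\<lambda>i. ratio (c i) v) [0..<k]"
  have Us: "set Us \<subseteq> carrier L"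
    using fractionsI[OF c v] by (auto simp: Us_def intro!: frac_closed)
  have "L.dependent K Us"
    using L.independent_length_le_dimension[OF K dim(1) _ Us] dim(2) by (auto simp: Us_def)
  then obtain Ks where Ks: "length Ks = length Us" "L.combine Ks Us = \<zero>\<^bsub>L\<^esub>" "set Ks \<subseteq> K" "set Ks \<noteq> {\<zero>\<^bsub>L\<^esub>}"
    using L.dependent_imp_non_trivial_combine[OF K Us] by blast
  have len: "length Ks = k"
    using Ks(1) by (simp add: Us_def)
  then have "Ks ! i \<in> K" if "i < k" for i
    using Ks(3) nth_mem[of i Ks] that by blast
  from common_denominator[of k "\<lambda>i. Ks ! i", OF this] obtain e a b where ab: "binary_form l e b" "\<not> F dvd b"
    "\<forall>i<k. binary_form l e (a i) \<and> Ks ! i = ratio (a i) b"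
    by blast
  have Ks_eq: "Ks = map (\<lambda>i. ratio (a i) b) [0..<k]"
    using len ab(3) by (intro nth_equalityI) auto
  have sum: "(\<Sum>i\<leftarrow>[0..<k]. a i * c i) = (\<Sum>i<k. a i * c i)"
    by (simp add: interv_sum_list_conv_sum_set_nat atLeast0LessThan)
  note b = binary_form_homogeneous[OF ab(1)]
  have combine: "L.combine Ks Us = ratio (\<Sum>i<k. a i * c i) (b * v) \<and> homogeneous (e + d) (\<Sum>i<k. a i * c i)"
    using combine_ratio[OF ab(1,2) v, of "[0..<k]" a c] ab(3) c unfolding Ks_eq Us_def sum by auto
  then have "(\<Sum>i<k. a i * c i, b * v) \<in> fractions F"
    using homogeneous_mult[OF b v(1)] not_dvd_mult[OF b v(1) ab(2) v(2)] by (meson fractionsI)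
  then have "F dvd (\<Sum>i<k. a i * c i)"
    using combine Ks(2) frac_eq_zero_iff by metis
  moreover have "\<exists>i<k. \<not> F dvd a i"
  proof (rule ccontr)
    assume "\<not> (\<exists>i<k. \<not> F dvd a i)"
    then have "Ks ! i = \<zero>\<^bsub>L\<^esub>" if "i < k" for i
      using that ab(3) frac_eq_zero_iff[OF binary_fraction[OF _ ab(1,2)]] by simp
    then have "set Ks \<subseteq> {\<zero>\<^bsub>L\<^esub>}"
      using len by (auto simp: in_set_conv_nth)
    \<comment> \<open>The nontriviality condition is \<open>set Ks \<noteq> {0}\<close>, which the
      empty list would satisfy as well.\<close>
    moreover have "k > 0"
      using dim(2) by simp
    then have "Ks \<noteq> []"
      using len by auto
    ultimately show False
      using Ks(4) by (cases Ks) auto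
  qed
  ultimately show ?thesis
    using ab(3) by blast
qed


lemma dependent_four_forms:
  assumes dim: "L.dimension n K (carrier L)" "n \<le> 3" and K: "subfield K L"
    and v: "homogeneous d v" "\<not> F dvd v"
    and c: "homogeneous d c0" "homogeneous d c1" "homogeneous d c2" "homogeneous d c3"
  obtains e a0 a1 a2 a3 where "binary_form l e a0" "binary_form l e a1" "binary_form l e a2" "binary_form l e a3"
    "\<not> (F dvd a0 \<and> F dvd a1 \<and> F dvd a2 \<and> F dvd a3)"
    "F dvd a0 * c0 + a1 * c1 + a2 * c2 + a3 * c3"
proof -
  define c where "c = (\<lambda>i::nat. if i = 0 then c0 else if i = 1 then c1 else if i = 2 then c2 else c3)"
  have "homogeneous d (c i)" for i
    using assms by (simp add: c_def)
  then obtain e a where a: "\<forall>i<4. binary_form l e (a i)" "\<exists>i<4. \<not> F dvd a i" "F dvd (\<Sum>i<4. a i * c i)"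
    using dependent_forms[OF dim(1) _ K v, of 4 c] dim(2) by auto
  have "(\<Sum>i<4. a i * c i) = a 0 * c0 + a 1 * c1 + a 2 * c2 + a 3 * c3"
    by (simp add: c_def eval_nat_numeral)
  moreover have "\<not> (F dvd a 0 \<and> F dvd a 1 \<and> F dvd a 2 \<and> F dvd a 3)"
    using a(2) by (auto simp: less_Suc_eq eval_nat_numeral)
  ultimately show thesis
    using a that[of e "a 0" "a 1" "a 2" "a 3"] by auto
qed

section \<open>The case where \<open>1\<close>, \<open>y\<close>, \<open>y^2\<close> are independent
  over \<open>K\<close>\<close>

lemma dvd_mult_u:
  assumes "F dvd u * A" "homogeneous d A"
  shows "F dvd A"
  using dvd_cancel[OF assms(1) u_not_dvd u_linear assms(2)] .

text \<open>Independence of \<open>1\<close>, \<open>y\<close>, \<open>y^2\<close> over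
  \<open>K\<close>, multiplied by \<open>u ^ 2\<close>: divisibility by \<open>F\<close> stands for
  being zero in the function field.\<close>

definition quadratic_independent :: bool
  where "quadratic_independent \<longleftrightarrow> (\<forall>e a b c. binary_form l e a \<longrightarrow> binary_form l e b \<longrightarrow> binary_form l e c \<longrightarrow>
    F dvd a * m ^ 2 + b * m * u + c * u ^ 2 \<longrightarrow> F dvd a \<and> F dvd b \<and> F dvd c)"

lemma quadratic_independentD:
  assumes "quadratic_independent" "binary_form l e a" "binary_form l e b" "binary_form l e c"
    "F dvd a * m ^ 2 + b * m * u + c * u ^ 2"
  shows "F dvd a" "F dvd b" "F dvd c"
  using assms unfolding quadratic_independent_def by blast+

text \<open>If \<open>F\<close> divides a nonzero form in \<open>l 0\<close> and \<open>l 1\<close>, then \<open>F\<close> is invariant under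
  translations in the direction \<open>p\<close>, hence divides the leading coefficient, with respect to \<open>m\<close>,
  of every form it divides. This is absurd for a cubic equation satisfied by \<open>m / u\<close>.\<close>

lemma binary_form_eq_0:
  assumes dim: "L.dimension n K (carrier L)" "n \<le> 3" and K: "subfield K L"
    and quadratic_independent and A: "binary_form l e A" "F dvd A"
  shows "A = 0"
proof (rule ccontr)
  assume "A \<noteq> 0"
  obtain G where G: "A = F * G"
    using A(2) by blast
  then have FG: "translate p F * translate p G = [:A:]"
    using translate_binary[OF A(1)] by (simp add: translate_mult)
  then have "translate p F \<noteq> 0" "translate p G \<noteq> 0"
    using \<open>A \<noteq> 0\<close> by auto
  \<comment> \<open>Degrees in the translation parameter add up, and the product is
    constant.\<close>
  then have "degree (translate p F) + degree (translate p G) = 0"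
    using degree_mult_eq[of "translate p F" "translate p G"] FG by simp
  then have "degree (translate p F) = 0"
    by simp
  then obtain c where "translate p F = [:c:]"
    by (rule degree_eq_zeroE)
  then have F: "translate p F = [:F:]"
    using poly_translate_0[of p F] by simp
  have h: "homogeneous 3 (u ^ 3)" "homogeneous 3 (m * u ^ 2)" "homogeneous 3 (m ^ 2 * u)" "homogeneous 3 (m ^ 3)"
    using homogeneous_power[OF u_linear, of 3] homogeneous_power[OF m_linear, of 3]
      homogeneous_mult[OF m_linear homogeneous_power[OF u_linear, of 2]]
      homogeneous_mult[OF homogeneous_power[OF m_linear, of 2] u_linear] by (simp_all add: numeral_3_eq_3)
  \<comment> \<open>The four forms are \<open>1\<close>, \<open>y\<close>, \<open>y^2\<close>,
    \<open>y^3\<close> multiplied by \<open>u ^ 3\<close>.\<close>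
  obtain e a0 a1 a2 a3 where a: "binary_form l e a0" "binary_form l e a1" "binary_form l e a2" "binary_form l e a3"
    "\<not> (F dvd a0 \<and> F dvd a1 \<and> F dvd a2 \<and> F dvd a3)"
    and rel: "F dvd a0 * u ^ 3 + a1 * (m * u ^ 2) + a2 * (m ^ 2 * u) + a3 * m ^ 3"
    by (rule dependent_four_forms[OF dim K h(1) not_dvd_power[OF u_linear u_not_dvd] h])
  from rel obtain S where S: "a0 * u ^ 3 + a1 * (m * u ^ 2) + a2 * (m ^ 2 * u) + a3 * m ^ 3 = F * S"
    by blast
  have "translate p m = [:m, 1:]" "translate p u = [:u:]"
    using translate_linear[OF m_linear] translate_binary[OF u_binary] m_p by simp_all
  then have "[:a0:] * [:u:] ^ 3 + [:a1:] * ([:m, 1:] * [:u:] ^ 2) + [:a2:] * ([:m, 1:] ^ 2 * [:u:]) + [:a3:] * [:m, 1:] ^ 3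
    = [:F:] * translate p S"
    using arg_cong[OF S, of "translate p"] F a(1-4)
    by (simp add: translate_add translate_mult translate_power translate_binary del: mult_pCons_left mult_pCons_right)
  \<comment> \<open>Only the cube of \<open>m + z\<close> reaches \<open>z^3\<close>, with
    coefficient 1, so the comparison isolates \<open>a3\<close>.\<close>
  then have "coeff ([:a0:] * [:u:] ^ 3 + [:a1:] * ([:m, 1:] * [:u:] ^ 2) + [:a2:] * ([:m, 1:] ^ 2 * [:u:]) + [:a3:] * [:m, 1:] ^ 3) 3
    = F * coeff (translate p S) 3"
    by simp
  then have a3: "F dvd a3"
    by (simp add: eval_nat_numeral)
  have "F dvd u * (a2 * m ^ 2 + a1 * m * u + a0 * u ^ 2)"
  proof -
    have "u * (a2 * m ^ 2 + a1 * m * u + a0 * u ^ 2)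
      = (a0 * u ^ 3 + a1 * (m * u ^ 2) + a2 * (m ^ 2 * u) + a3 * m ^ 3) - a3 * m ^ 3"
      by (simp add: algebra_simps eval_nat_numeral)
    then show ?thesis
      by (simp only: dvd_diff[OF rel dvd_mult2[OF a3]])
  qed
  moreover have "homogeneous (e + 2) (a2 * m ^ 2 + a1 * m * u + a0 * u ^ 2)"
    using homogeneous_mult[OF binary_form_homogeneous[OF a(3)] homogeneous_power[OF m_linear, of 2]]
      homogeneous_mult[OF homogeneous_mult[OF binary_form_homogeneous[OF a(2)] m_linear] u_linear]
      homogeneous_mult[OF binary_form_homogeneous[OF a(1)] homogeneous_power[OF u_linear, of 2]]
    by (auto intro!: homogeneous_add)
  ultimately have "F dvd a2 * m ^ 2 + a1 * m * u + a0 * u ^ 2"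
    by (rule dvd_mult_u)
  from quadratic_independentD[OF assms(4) a(3,2,1) this] a3 a(5) show False
    by blast
qed

text \<open>The product of the coefficient matrices. Substitution multiplies binary forms of degree
  \<open>e\<close> by \<open>q' ^ e\<close>, and the pullbacks \<open>u * n'\<close> of
  \<open>m\<close> and \<open>q' * u\<close> of \<open>u\<close> share the factor
  \<open>u\<close>.\<close>

lemma moebius_comp:
  assumes "moebius e n q" "moebius e' n' q'"
  obtains n'' q'' where "moebius (e + e') n'' q''"
    "subst (jonq n' q') n = q' ^ e * u * n''" "subst (jonq n' q') q = q' ^ e * u * q''"
proof -
  obtain a b c d where nq: "binary_form l e a" "binary_form l e b" "binary_form l e c" "binary_form l e d"
    "n = a * m + b * u" "q = c * m + d * u"
    using assms(1) by (auto simp: moebius_def)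
  obtain a' b' c' d' where nq': "binary_form l e' a'" "binary_form l e' b'" "binary_form l e' c'" "binary_form l e' d'"
    "n' = a' * m + b' * u" "q' = c' * m + d' * u"
    using assms(2) by (auto simp: moebius_def)
  have comp: "moebius (e + e') (a * n' + b * q') (c * n' + d * q')"
    unfolding moebius_def
  proof (intro exI conjI)
    show "a * n' + b * q' = (a * a' + b * c') * m + (a * b' + b * d') * u"
      "c * n' + d * q' = (c * a' + d * c') * m + (c * b' + d * d') * u"
      by (simp_all add: nq' algebra_simps)
  qed (intro binary_form_add binary_form_mult nq nq')+
  show thesis
  proof (rule that[OF comp])
    show "subst (jonq n' q') n = q' ^ e * u * (a * n' + b * q')"
      using subst_jonq_binary[OF nq(1)] subst_jonq_binary[OF nq(2)]
      by (simp add: nq(5) subst.evaluate_add subst.evaluate_mult algebra_simps)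
    show "subst (jonq n' q') q = q' ^ e * u * (c * n' + d * q')"
      using subst_jonq_binary[OF nq(3)] subst_jonq_binary[OF nq(4)]
      by (simp add: nq(6) subst.evaluate_add subst.evaluate_mult algebra_simps)
  qed
qed

text \<open>The cross difference is a quadratic polynomial in \<open>y\<close> with binary
  coefficients: independence puts each coefficient in the ideal of \<open>F\<close>, and
  \<open>binary_form_eq_0\<close> then makes it zero.\<close>

lemma moebius_unique:
  assumes dim: "L.dimension k K (carrier L)" "k \<le> 3" and K: "subfield K L"
    and indep: quadratic_independent
    and nq: "moebius e n q" "moebius e' n' q'" and dvd: "F dvd n * q' - n' * q"
  shows "n * q' = n' * q"
proof -
  obtain a b c d where nq: "binary_form l e a" "binary_form l e b" "binary_form l e c" "binary_form l e d"
    "n = a * m + b * u" "q = c * m + d * u"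
    using nq(1) by (auto simp: moebius_def)
  obtain a' b' c' d' where nq': "binary_form l e' a'" "binary_form l e' b'" "binary_form l e' c'" "binary_form l e' d'"
    "n' = a' * m + b' * u" "q' = c' * m + d' * u"
    using assms(6) by (auto simp: moebius_def)
  let ?A = "a * c' - c * a'" and ?B = "(a * d' + b * c') - (d * a' + c * b')" and ?C = "b * d' - d * b'"
  have bin: "binary_form l (e + e') ?A" "binary_form l (e + e') ?B" "binary_form l (e + e') ?C"
    by (intro binary_form_add binary_form_diff binary_form_mult nq nq')+
  have eq: "n * q' - n' * q = ?A * m ^ 2 + ?B * m * u + ?C * u ^ 2"
    by (simp add: nq nq' algebra_simps power2_eq_square)
  then have "F dvd ?A" "F dvd ?B" "F dvd ?C"
    using quadratic_independentD[OF indep bin] dvd by simp_all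
  then have "?A = 0" "?B = 0" "?C = 0"
    using binary_form_eq_0[OF dim K indep] bin by blast+
  then have "n * q' - n' * q = 0"
    unfolding eq by simp
  then show ?thesis by simp
qed

lemma fractions_moebius: "moebius e n q \<Longrightarrow> \<not> F dvd q \<Longrightarrow> (n, q) \<in> fractions F"
  using moebius_homogeneous fractionsI by blast

lemma fractions_m: "(m, u) \<in> fractions F"
  by (rule fractions_u[OF m_linear])

lemma moebius_m_u: "moebius 0 m u"
  unfolding moebius_def using binary_form_const[of l 1]
  by (intro exI[of _ 1] exI[of _ 0]) simp

text \<open>The functions \<open>1\<close>, \<open>y\<close>, \<open>\<sigma> y\<close>, \<open>y \<sigma> y\<close> with \<open>y = m / u\<close> are linearly dependent over \<open>K\<close>,
  which exhibits \<open>\<sigma> y\<close> as a fractional linear transform of \<open>y\<close>.\<close>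

lemma exists_moebius:
  assumes dim: "L.dimension k K (carrier L)" "k \<le> 3" and K: "subfield K L"
    and indep: quadratic_independent and \<sigma>: "\<sigma> \<in> carrier (Gal L K)"
  shows "\<exists>n q. represents \<sigma> n q"
proof -
  have "\<sigma> (ratio m u) \<in> carrier L"
    using \<sigma> frac_closed[OF fractions_m] by (auto simp: Gal_carrier dest: ring_hom_closed)
  then obtain Y V where YV: "(Y, V) \<in> fractions F" "\<sigma> (ratio m u) = ratio Y V"
    by (rule function_field_cases)
  then obtain d where d: "homogeneous d Y" "homogeneous d V" "\<not> F dvd V"
    by (auto simp: fractions_iff)
  have h: "homogeneous (1 + d) (u * V)" "homogeneous (1 + d) (m * V)" "homogeneous (1 + d) (u * Y)" "homogeneous (1 + d) (m * Y)"
    by (intro homogeneous_mult u_linear m_linear d)+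
  obtain e a0 a1 a2 a3 where a: "binary_form l e a0" "binary_form l e a1" "binary_form l e a2" "binary_form l e a3"
    "\<not> (F dvd a0 \<and> F dvd a1 \<and> F dvd a2 \<and> F dvd a3)"
    and rel: "F dvd a0 * (u * V) + a1 * (m * V) + a2 * (u * Y) + a3 * (m * Y)"
    by (rule dependent_four_forms[OF dim K h(1) not_dvd_mult[OF u_linear d(2) u_not_dvd d(3)] h])
  \<comment> \<open>The relation \<open>a0 + a1 y + a2 \<sigma>y + a3 y \<sigma>y = 0\<close> solved
    for \<open>\<sigma>y\<close>.\<close>
  let ?n = "- a1 * m + - a0 * u" and ?q = "a3 * m + a2 * u"
  have moebius: "moebius e ?n ?q"
    unfolding moebius_def using a binary_form_uminus by blast
  have linear: "F dvd a \<and> F dvd b" if "binary_form l e a" "binary_form l e b" "F dvd a * m + b * u" for a b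
  proof -
    have "F dvd 0 * m ^ 2 + a * m * u + b * u ^ 2"
      using dvd_mult2[OF that(3), of u] by (simp add: algebra_simps power2_eq_square)
    then show ?thesis
      using quadratic_independentD[OF indep binary_form_0 that(1,2)] by blast
  qed
  \<comment> \<open>If \<open>a3 y + a2\<close> were zero, so would be \<open>a1 y + a0\<close>, and
    all four coefficients would vanish on the curve.\<close>
  have q: "\<not> F dvd ?q"
  proof
    assume q: "F dvd ?q"
    have "F dvd (a0 * (u * V) + a1 * (m * V) + a2 * (u * Y) + a3 * (m * Y)) - ?q * Y"
      by (rule dvd_diff[OF rel dvd_mult2[OF q]])
    also have "(a0 * (u * V) + a1 * (m * V) + a2 * (u * Y) + a3 * (m * Y)) - ?q * Y = V * (a1 * m + a0 * u)"
      by (simp add: algebra_simps)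
    finally have "F dvd a1 * m + a0 * u"
      by (rule dvd_cancel[OF _ d(3,2)])
        (rule homogeneous_add[OF homogeneous_mult homogeneous_mult]
          binary_form_homogeneous[OF a(1)] binary_form_homogeneous[OF a(2)] u_linear m_linear)+
    then show False
      using linear[OF a(2,1)] linear[OF a(4,3) q] a(5) by blast
  qed
  have "Y * ?q - ?n * V = a0 * (u * V) + a1 * (m * V) + a2 * (u * Y) + a3 * (m * Y)"
    by (simp add: algebra_simps)
  then have "ratio Y V = ratio ?n ?q"
    using frac_eq_iff[OF YV(1) fractions_moebius[OF moebius q]] rel by simp
  then show ?thesis
    using moebius q YV(2) unfolding represents_def by metis
qed

lemma Gal_mult_apply:
  "\<sigma> \<in> carrier (Gal L K) \<Longrightarrow> \<tau> \<in> carrier (Gal L K) \<Longrightarrow> x \<in> carrier L \<Longrightarrow> (\<tau> \<otimes>\<^bsub>Gal L K\<^esub> \<sigma>) x = \<tau> (\<sigma> x)"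
  by (simp add: Gal_mult compose_def)

text \<open>Representatives may be chosen freely: the chosen transform for a product and the one
  obtained by substitution have the same value at \<open>y\<close>, hence agree as polynomials by
  uniqueness.\<close>

lemma extends_if_quadratic_independent:
  assumes dim: "L.dimension k K (carrier L)" "k \<le> 3" and K: "subfield K L"
    and indep: quadratic_independent
  shows "extends_to_subgroup F l (Jonq l)"
proof -
  interpret G: group "Gal L K" by (rule group_Gal_L)
  let ?G = "carrier (Gal L K)"
  obtain N Q where NQ: "\<And>\<sigma>. \<sigma> \<in> ?G \<Longrightarrow> represents \<sigma> (N \<sigma>) (Q \<sigma>)"
    using exists_moebius[OF dim K indep] by metis
  show ?thesis
  proof (rule extends_to_subgroupI[OF NQ])
    fix \<sigma> \<tau> assume \<sigma>: "\<sigma> \<in> ?G" and \<tau>: "\<tau> \<in> ?G"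
    let ?\<rho> = "\<tau> \<otimes>\<^bsub>Gal L K\<^esub> \<sigma>" and ?J = "jonq (N \<tau>) (Q \<tau>)"
    have \<rho>: "?\<rho> \<in> ?G"
      using \<sigma> \<tau> by simp
    obtain e e' f where m: "moebius e (N \<sigma>) (Q \<sigma>)" "moebius e' (N \<tau>) (Q \<tau>)" "moebius f (N ?\<rho>) (Q ?\<rho>)"
      using NQ[OF \<sigma>] NQ[OF \<tau>] NQ[OF \<rho>] by (auto simp: represents_def)
    have not_dvd: "\<not> F dvd Q \<sigma>" "\<not> F dvd Q \<tau>" "\<not> F dvd Q ?\<rho>"
      using NQ[OF \<sigma>] NQ[OF \<tau>] NQ[OF \<rho>] by (auto simp: represents_def)
    obtain n q where nq: "moebius (e + e') n q" "subst ?J (N \<sigma>) = Q \<tau> ^ e * u * n" "subst ?J (Q \<sigma>) = Q \<tau> ^ e * u * q"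
      using moebius_comp[OF m(1,2)] .
    have "ratio (subst ?J (N \<sigma>)) (subst ?J (Q \<sigma>)) = ratio (N ?\<rho>) (Q ?\<rho>)"
      using \<sigma>_ratio[OF \<tau> NQ[OF \<tau>] fractions_moebius[OF m(1) not_dvd(1)]] NQ[OF \<sigma>] NQ[OF \<rho>]
        Gal_mult_apply[OF \<sigma> \<tau> frac_closed[OF fractions_m]] by (simp add: represents_def)
    then have "F dvd subst ?J (N \<sigma>) * Q ?\<rho> - N ?\<rho> * subst ?J (Q \<sigma>)"
      using frac_eq_iff[OF fractions_subst_jonq[OF \<tau> NQ[OF \<tau>] fractions_moebius[OF m(1) not_dvd(1)]]
          fractions_moebius[OF m(3) not_dvd(3)]] by simp
    also have "subst ?J (N \<sigma>) * Q ?\<rho> - N ?\<rho> * subst ?J (Q \<sigma>) = Q \<tau> ^ e * (u * (n * Q ?\<rho> - N ?\<rho> * q))"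
      by (simp add: nq algebra_simps)
    finally have *: "F dvd Q \<tau> ^ e * (u * (n * Q ?\<rho> - N ?\<rho> * q))" .
    have hom: "homogeneous (Suc (e + e') + Suc f) (n * Q ?\<rho> - N ?\<rho> * q)"
      using homogeneous_mult[OF moebius_homogeneous(1)[OF nq(1)] moebius_homogeneous(2)[OF m(3)]]
        homogeneous_mult[OF moebius_homogeneous(2)[OF nq(1)] moebius_homogeneous(1)[OF m(3)]]
      by (simp add: homogeneous_diff mult.commute)
    \<comment> \<open>\<open>Q \<tau>\<close> and \<open>u\<close> are nonzero on the curve, so the
      common factor of the substituted fraction cancels.\<close>
    have "F dvd n * Q ?\<rho> - N ?\<rho> * q"
      by (rule dvd_mult_u[OF dvd_cancel_power[OF * not_dvd(2) moebius_homogeneous(2)[OF m(2)]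
              homogeneous_mult[OF u_linear hom]] hom])
    then have "n * Q ?\<rho> = N ?\<rho> * q"
      by (rule moebius_unique[OF dim K indep nq(1) m(3)])
    then show "subst ?J (N \<sigma>) * Q ?\<rho> = N ?\<rho> * subst ?J (Q \<sigma>)"
      unfolding nq(2,3) by (simp only: mult.assoc mult.left_commute[of "N ?\<rho>"])
  next
    let ?e = "\<one>\<^bsub>Gal L K\<^esub>"
    obtain e where m: "moebius e (N ?e) (Q ?e)" "\<not> F dvd Q ?e" "?e (ratio m u) = ratio (N ?e) (Q ?e)"
      using NQ[OF G.one_closed] by (auto simp: represents_def)
    have "?e (ratio m u) = ratio m u"
      using frac_closed[OF fractions_m] by (simp add: Gal_one)
    with m(3) have "ratio (N ?e) (Q ?e) = ratio m u"
      by (rule trans[OF sym])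
    then have "F dvd N ?e * u - m * Q ?e"
      using frac_eq_iff[OF fractions_moebius[OF m(1,2)] fractions_m] by simp
    then have "N ?e * u = m * Q ?e"
      by (rule moebius_unique[OF dim K indep m(1) moebius_m_u])
    then show "N ?e * u = Q ?e * m"
      by (simp only: mult.commute[of m])
  qed
qed

text \<open>If \<open>y = m / u\<close> satisfies a quadratic equation over \<open>K\<close>, then each \<open>\<sigma> y\<close> is \<open>y\<close> or the other
  root \<open>s - y\<close>, where \<open>s\<close> is a fraction of binary forms.\<close>

lemma quadratic_conjugates:
  assumes "\<not> quadratic_independent"
  obtains e s t where "binary_form l e s" "binary_form l e t" "\<not> F dvd t"
    "\<And>\<sigma>. \<sigma> \<in> carrier (Gal L K) \<Longrightarrow> \<sigma> (ratio m u) = ratio m u \<or> \<sigma> (ratio m u) = ratio (s * u - t * m) (t * u)"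
proof -
  obtain e a b c where abc: "binary_form l e a" "binary_form l e b" "binary_form l e c"
    and rel: "F dvd a * m ^ 2 + b * m * u + c * u ^ 2" and nz: "\<not> (F dvd a \<and> F dvd b \<and> F dvd c)"
    using assms unfolding quadratic_independent_def by blast
  show thesis
  proof (cases "F dvd a")
    case True
    have "F dvd (a * m ^ 2 + b * m * u + c * u ^ 2) - a * m ^ 2"
      by (rule dvd_diff[OF rel dvd_mult2[OF True]])
    also have "(a * m ^ 2 + b * m * u + c * u ^ 2) - a * m ^ 2 = u * (b * m + c * u)"
      by (simp add: algebra_simps power2_eq_square)
    finally have bc: "F dvd b * m + c * u"
      by (rule dvd_mult_u) (rule homogeneous_add[OF homogeneous_mult homogeneous_mult]
          binary_form_homogeneous[OF abc(2)] binary_form_homogeneous[OF abc(3)] u_linear m_linear)+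
    have b: "\<not> F dvd b"
    proof
      assume b: "F dvd b"
      have "F dvd u * c"
        using dvd_diff[OF bc dvd_mult2[OF b, of m]] by (simp add: mult.commute)
      then show False
        using dvd_mult_u[OF _ binary_form_homogeneous[OF abc(3)]] b True nz by blast
    qed
    have "F dvd m * b - - c * u"
      using bc by (simp add: mult.commute)
    then have y: "ratio m u = ratio (- c) b"
      using frac_eq_iff[OF fractions_m binary_fraction[OF binary_form_uminus[OF abc(3)] abc(2) b]] by simp
    have "ratio (- c) b \<in> K"
      using K_iff binary_form_uminus[OF abc(3)] abc(2) b by blast
    then have "\<sigma> (ratio m u) = ratio m u" if "\<sigma> \<in> carrier (Gal L K)" for \<sigma>
      using that unfolding y by (auto simp: Gal_carrier)
    \<comment> \<open>Here \<open>y\<close> lies in \<open>K\<close> and only the first alternative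
      occurs; \<open>s = 0\<close>, \<open>t = 1\<close> are placeholders.\<close>
    then show thesis
      using that[OF binary_form_0, of 0 1] binary_form_const[of l 1] nonunit by simp
  next
    case False
    have \<sigma>y: "\<sigma> (ratio m u) = ratio m u \<or> \<sigma> (ratio m u) = ratio (- b * u - a * m) (a * u)"
      if \<sigma>: "\<sigma> \<in> carrier (Gal L K)" for \<sigma>
    proof -
      have hom: "\<sigma> \<in> ring_hom L L"
        using \<sigma> by (simp add: Gal_carrier)
      have "\<sigma> (ratio m u) \<in> carrier L"
        using ring_hom_closed[OF hom frac_closed[OF fractions_m]] .
      then obtain Y V where YV: "(Y, V) \<in> fractions F" "\<sigma> (ratio m u) = ratio Y V"
        by (rule function_field_cases)
      then obtain d where d: "homogeneous d Y" "homogeneous d V" "\<not> F dvd V"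
        by (auto simp: fractions_iff)
      have K: "ratio x a \<in> K" "(x, a) \<in> fractions F" if "binary_form l e x" for x
        using that abc(1) False K_iff binary_fraction by blast+
      \<comment> \<open>The monic quadratic equation of \<open>y\<close>; its leading coefficient 1
        is written \<open>ratio a a\<close> to share the denominator \<open>a\<close>.\<close>
      define P where "P y = ratio a a \<otimes>\<^bsub>L\<^esub> (y \<otimes>\<^bsub>L\<^esub> y) \<oplus>\<^bsub>L\<^esub> (ratio b a \<otimes>\<^bsub>L\<^esub> y \<oplus>\<^bsub>L\<^esub> ratio c a)" for y
      have P: "P (ratio S T) = \<zero>\<^bsub>L\<^esub> \<longleftrightarrow> F dvd a * S ^ 2 + b * S * T + c * T ^ 2"
        if ST: "(S, T) \<in> fractions F" for S T
      proof -
        obtain f where f: "homogeneous f S" "homogeneous f T" "\<not> F dvd T"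
          using ST by (auto simp: fractions_iff)
        note fr = fractions_mult[OF ST ST] fractions_mult[OF K(2)[OF abc(1)] fractions_mult[OF ST ST]]
          fractions_mult[OF K(2)[OF abc(2)] ST]
          fractions_add[OF fractions_mult[OF K(2)[OF abc(2)] ST] K(2)[OF abc(3)]]
        let ?R = "a * S ^ 2 + b * S * T + c * T ^ 2" and ?w = "a * a * T"
        have num: "a * (S * S) * (a * T * a) + (b * S * a + c * (a * T)) * (a * (T * T)) = ?w * ?R"
          by (simp add: algebra_simps power2_eq_square)
        have ah: "homogeneous e a"
          by (rule binary_form_homogeneous[OF abc(1)])
        have w: "homogeneous (e + e + f) ?w" "\<not> F dvd ?w"
          by (rule homogeneous_mult[OF homogeneous_mult[OF ah ah] f(2)],
              rule not_dvd_mult[OF homogeneous_mult[OF ah ah] f(2) not_dvd_mult[OF ah ah False False] f(3)])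
        have R: "homogeneous (e + 2 * f) ?R"
          using homogeneous_mult[OF ah homogeneous_power[OF f(1), of 2]]
            homogeneous_mult[OF homogeneous_mult[OF binary_form_homogeneous[OF abc(2)] f(1)] f(2)]
            homogeneous_mult[OF binary_form_homogeneous[OF abc(3)] homogeneous_power[OF f(2), of 2]]
          by (auto intro!: homogeneous_add simp: mult_2 add.assoc)
        have "P (ratio S T) = ratio (?w * ?R) (a * (T * T) * (a * T * a))"
          unfolding P_def frac_mult[OF ST ST] frac_mult[OF K(2)[OF abc(1)] fr(1)] frac_mult[OF K(2)[OF abc(2)] ST]
            frac_add[OF fr(3) K(2)[OF abc(3)]] frac_add[OF fr(2) fr(4)] num ..
        moreover have "(?w * ?R, a * (T * T) * (a * T * a)) \<in> fractions F"
          using fractions_add[OF fr(2) fr(4)] unfolding num .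
        ultimately have "P (ratio S T) = \<zero>\<^bsub>L\<^esub> \<longleftrightarrow> F dvd ?w * ?R"
          using frac_eq_zero_iff by simp
        then show ?thesis
          using dvd_cancel[OF _ w(2,1) R] by auto
      qed
      have "\<sigma> (P (ratio m u)) = P (\<sigma> (ratio m u))"
        using K[OF abc(1)] K[OF abc(2)] K[OF abc(3)] \<sigma> frac_closed[OF fractions_m] frac_closed
        unfolding P_def by (simp add: ring_hom_add[OF hom] ring_hom_mult[OF hom] Gal_carrier)
      moreover have "P (ratio m u) = \<zero>\<^bsub>L\<^esub>"
        using P[OF fractions_m] rel by simp
      moreover have "\<sigma> \<zero>\<^bsub>L\<^esub> = \<zero>\<^bsub>L\<^esub>"
        by (rule ring_hom_zero[OF hom L.ring_axioms L.ring_axioms])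
      ultimately have rel': "F dvd a * Y ^ 2 + b * Y * V + c * V ^ 2"
        using P[OF YV(1)] YV(2) by simp
      \<comment> \<open>Subtracting the equations of \<open>y\<close> and \<open>\<sigma>y\<close>
        removes \<open>c\<close> and leaves \<open>(y - \<sigma>y) * (a (y + \<sigma>y) + b)\<close>
        up to denominators, whence \<open>s = - b\<close> and \<open>t = a\<close>.\<close>
      have "F dvd (a * m ^ 2 + b * m * u + c * u ^ 2) * V ^ 2 - (a * Y ^ 2 + b * Y * V + c * V ^ 2) * u ^ 2"
        by (rule dvd_diff[OF dvd_mult2[OF rel] dvd_mult2[OF rel']])
      also have "\<dots> = (m * V - Y * u) * (Y * (a * u) - (- b * u - a * m) * V)"
        by (simp add: algebra_simps power2_eq_square)
      finally have dvd: "F dvd (m * V - Y * u) * (Y * (a * u) - (- b * u - a * m) * V)" .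
      have frac2: "(- b * u - a * m, a * u) \<in> fractions F"
        by (rule fractionsI[OF homogeneous_diff[OF homogeneous_mult homogeneous_mult] homogeneous_mult])
          (rule binary_form_homogeneous[OF binary_form_uminus[OF abc(2)]] binary_form_homogeneous[OF abc(1)]
            u_linear m_linear not_dvd_mult[OF binary_form_homogeneous[OF abc(1)] u_linear False u_not_dvd])+
      have h: "homogeneous (1 + d) (m * V - Y * u)" "homogeneous (d + (e + 1)) (Y * (a * u) - (- b * u - a * m) * V)"
      proof -
        have "homogeneous (1 + d) (u * Y)" "homogeneous (1 + d) (m * V)"
          by (intro homogeneous_mult u_linear m_linear d)+
        then show "homogeneous (1 + d) (m * V - Y * u)"
          by (simp add: homogeneous_diff mult.commute)
        have "homogeneous (d + (e + 1)) (V * (- b * u - a * m))"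
          by (intro homogeneous_mult homogeneous_diff d u_linear m_linear binary_form_homogeneous
              binary_form_uminus abc)
        moreover have "homogeneous (d + (e + 1)) (Y * (a * u))"
          by (intro homogeneous_mult d u_linear binary_form_homogeneous abc)
        ultimately show "homogeneous (d + (e + 1)) (Y * (a * u) - (- b * u - a * m) * V)"
          by (simp add: homogeneous_diff mult.commute[of V])
      qed
      from prime[OF h dvd] show ?thesis
        using frac_eq_iff[OF fractions_m YV(1)] frac_eq_iff[OF YV(1) frac2] YV(2) by auto
    qed
    show thesis
      by (rule that[OF binary_form_uminus[OF abc(2)] abc(1) False]) (rule \<sigma>y)
  qed
qed

text \<open>Only two transformations are used, the identity and \<open>y \<mapsto> s - y\<close>.
  Their composition table holds identically in \<open>y\<close>, so every required identity is
  polynomial.\<close>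

lemma extends_if_quadratic:
  assumes "\<not> quadratic_independent"
  shows "extends_to_subgroup F l (Jonq l)"
proof -
  interpret G: group "Gal L K" by (rule group_Gal_L)
  let ?G = "carrier (Gal L K)" and ?y = "ratio m u"
  obtain e s t where st: "binary_form l e s" "binary_form l e t" "\<not> F dvd t"
    and conj: "\<And>\<sigma>. \<sigma> \<in> ?G \<Longrightarrow> \<sigma> ?y = ?y \<or> \<sigma> ?y = ratio (s * u - t * m) (t * u)"
    using quadratic_conjugates[OF assms] by metis
  let ?n = "s * u - t * m" and ?q = "t * u"
  have moebius: "moebius e ?n ?q"
    unfolding moebius_def
    by (rule exI[of _ "- t"], rule exI[of _ s], rule exI[of _ 0], rule exI[of _ t])
      (simp add: st binary_form_uminus algebra_simps)
  have q: "\<not> F dvd ?q"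
    by (rule not_dvd_mult[OF binary_form_homogeneous[OF st(2)] u_linear st(3) u_not_dvd])
  note f = fractions_moebius[OF moebius q]
  \<comment> \<open>The choice depends only on whether \<open>\<sigma>\<close> fixes
    \<open>y\<close>, so it stays consistent even if \<open>s - y\<close> and \<open>y\<close>
    coincide on the curve.\<close>
  define N where "N \<sigma> = (if \<sigma> ?y = ?y then m else ?n)" for \<sigma> :: "((3, 'k) mpoly \<times> (3, 'k) mpoly) set \<Rightarrow> ((3, 'k) mpoly \<times> (3, 'k) mpoly) set"
  define Q where "Q \<sigma> = (if \<sigma> ?y = ?y then u else ?q)" for \<sigma> :: "((3, 'k) mpoly \<times> (3, 'k) mpoly) set \<Rightarrow> ((3, 'k) mpoly \<times> (3, 'k) mpoly) set"
  have rep: "represents \<sigma> (N \<sigma>) (Q \<sigma>)" if "\<sigma> \<in> ?G" for \<sigma>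
    using conj[OF that] moebius_m_u moebius u_not_dvd q by (auto simp: represents_def N_def Q_def)
  show ?thesis
  proof (rule extends_to_subgroupI[OF rep])
    fix \<sigma> \<tau> assume \<sigma>: "\<sigma> \<in> ?G" and \<tau>: "\<tau> \<in> ?G"
    let ?\<rho> = "\<tau> \<otimes>\<^bsub>Gal L K\<^esub> \<sigma>" and ?J = "jonq (N \<tau>) (Q \<tau>)"
    have \<rho>y: "?\<rho> ?y = \<tau> (\<sigma> ?y)"
      by (rule Gal_mult_apply[OF \<sigma> \<tau> frac_closed[OF fractions_m]])
    have J: "subst ?J ?n = Q \<tau> ^ e * s * (Q \<tau> * u) - Q \<tau> ^ e * t * (u * N \<tau>)"
      "subst ?J ?q = Q \<tau> ^ e * t * (Q \<tau> * u)"
      by (simp_all add: subst_diff subst.evaluate_mult subst_jonq_binary[OF st(1)] subst_jonq_binary[OF st(2)])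
    have \<tau>n: "\<tau> (ratio ?n ?q) = ratio (subst ?J ?n) (subst ?J ?q)"
      by (rule \<sigma>_ratio[OF \<tau> rep[OF \<tau>] f])
    note fJ = fractions_subst_jonq[OF \<tau> rep[OF \<tau>] f]
    show "subst ?J (N \<sigma>) * Q ?\<rho> = N ?\<rho> * subst ?J (Q \<sigma>)"
    proof (cases "\<sigma> ?y = ?y")
      case True
      then have "N ?\<rho> = N \<tau>" "Q ?\<rho> = Q \<tau>"
        using \<rho>y by (simp_all add: N_def Q_def)
      then show ?thesis
        using True by (simp add: N_def[of \<sigma>] Q_def[of \<sigma>] algebra_simps)
    next
      case \<sigma>y: False
      then have "\<sigma> ?y = ratio ?n ?q"
        using conj[OF \<sigma>] by blast
      then have *: "?\<rho> ?y = ratio (subst ?J ?n) (subst ?J ?q)"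
        using \<rho>y \<tau>n by simp
      show ?thesis
      proof (cases "\<tau> ?y = ?y")
        case True
        then have NQ: "N \<tau> = m" "Q \<tau> = u"
          by (simp_all add: N_def Q_def)
        have "subst ?J ?n * ?q = ?n * subst ?J ?q"
          unfolding J by (simp add: NQ algebra_simps)
        then have "?\<rho> ?y = ratio ?n ?q"
          using * frac_eq_iff[OF fJ f] by simp
        then have "?\<rho> ?y \<noteq> ?y"
          using \<sigma>y \<open>\<sigma> ?y = ratio ?n ?q\<close> by simp
        then show ?thesis
          using \<sigma>y \<open>subst ?J ?n * ?q = ?n * subst ?J ?q\<close> by (simp add: N_def Q_def)
      next
        case False
        then have NQ: "N \<tau> = ?n" "Q \<tau> = ?q"
          by (simp_all add: N_def Q_def)
        \<comment> \<open>This is \<open>s - (s - y) = y\<close> with denominators cleared.\<close>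
        have "subst ?J ?n * u = m * subst ?J ?q"
          unfolding J by (simp add: NQ algebra_simps)
        then have "?\<rho> ?y = ?y"
          using * frac_eq_iff[OF fJ fractions_m] by simp
        then show ?thesis
          using \<sigma>y \<open>subst ?J ?n * u = m * subst ?J ?q\<close> by (simp add: N_def Q_def)
      qed
    qed
  next
    have "\<one>\<^bsub>Gal L K\<^esub> ?y = ?y"
      using frac_closed[OF fractions_m] by (simp add: Gal_one)
    then show "N \<one>\<^bsub>Gal L K\<^esub> * u = Q \<one>\<^bsub>Gal L K\<^esub> * m"
      by (simp add: N_def Q_def mult.commute)
  qed
qed

lemma extends:
  assumes "L.dimension k K (carrier L)" "k \<le> 3" "subfield K L"
  shows "extends_to_subgroup F l (Jonq l)"
  using extends_if_quadratic extends_if_quadratic_independent[OF assms] by blast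

end

section \<open>Choice of coordinates\<close>

text \<open>The right-hand side is the form \<open>x_i - (p_i / p_k) x_k\<close>, which vanishes at
  \<open>p\<close>; the forms vanishing at \<open>p\<close> are a plane with basis \<open>a\<close>,
  \<open>b\<close>.\<close>

lemma vanishing_linear_forms_span:
  fixes a b p :: "3 \<Rightarrow> 'k::field"
  assumes pk: "p k \<noteq> 0" and a: "(\<Sum>i\<in>UNIV. a i * p i) = 0" and b: "(\<Sum>i\<in>UNIV. b i * p i) = 0"
    and indep: "\<And>s t. (\<forall>i. s * a i + t * b i = 0) \<Longrightarrow> s = 0 \<and> t = 0"
  shows "\<exists>s t. \<forall>r. s * a r + t * b r = (if r = i then 1 else 0) - (if r = k then p i / p k else 0)"
proof (cases "i = k")
  case True
  then show ?thesis
    using pk by (intro exI[of _ 0]) simp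
next
  case False
  have "card (UNIV - {i, k} :: 3 set) = 1"
    using False by (simp add: card_Diff_subset)
  then obtain j where j: "UNIV - {i, k} = {j}"
    by (auto simp: card_1_singleton_iff)
  then have ij: "j \<noteq> i" "j \<noteq> k" and UNIV: "UNIV = {i, j, k}"
    by auto
  have r: "r = i \<or> r = j \<or> r = k" for r
    using UNIV by auto
  have sum: "(\<Sum>r\<in>UNIV. f r) = f i + f j + f k" for f :: "3 \<Rightarrow> 'k"
    unfolding UNIV using ij False by (simp add: add.assoc)
  have ak: "a k = - (a i * p i + a j * p j) / p k" and bk: "b k = - (b i * p i + b j * p j) / p k"
    using minus_unique[OF a[unfolded sum]] minus_unique[OF b[unfolded sum]] pk by (simp_all add: field_simps)
  \<comment> \<open>The minor for the columns \<open>i\<close> and \<open>j\<close>; the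
    coefficients below come from Cramer's rule.\<close>
  define D where "D = a i * b j - a j * b i"
  have 1: "b j * a k - a j * b k = - D * p i / p k" and 2: "b i * a k - a i * b k = D * p j / p k"
    unfolding ak bk D_def using pk by (simp_all add: field_simps)
  \<comment> \<open>Since both forms vanish at \<open>p\<close>, the minors involving column
    \<open>k\<close> are multiples of \<open>D\<close>. With \<open>D = 0\<close>, independence
    applied to the resulting relations kills all entries in columns \<open>i\<close> and
    \<open>j\<close>, and then \<open>a = 0\<close>.\<close>
  have "D \<noteq> 0"
  proof
    assume D: "D = 0"
    then have D': "a i * b j = a j * b i"
      by (simp add: D_def)
    have "b j * a r + - a j * b r = 0" "b i * a r + - a i * b r = 0" for r
      using r[of r] 1 2 D D' by (auto simp: mult.commute)
    then have z: "b j = 0" "a j = 0" "b i = 0" "a i = 0"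
      using indep[of "b j" "- a j"] indep[of "b i" "- a i"] by auto
    then have "a k = 0"
      by (simp add: ak)
    then have "1 * a x + 0 * b x = 0" for x
      using r[of x] z by auto
    then show False
      using indep[of 1 0] by simp
  qed
  have k: "(b j * a k - a j * b k) / D = - (p i / p k)"
    unfolding 1 using \<open>D \<noteq> 0\<close> by simp
  have i: "(b j * a i - a j * b i) / D = 1"
    using \<open>D \<noteq> 0\<close> by (simp add: D_def mult.commute)
  have "b j / D * a r + - a j / D * b r = (if r = i then 1 else 0) - (if r = k then p i / p k else 0)" for r
  proof -
    have "b j / D * a r + - a j / D * b r = (b j * a r - a j * b r) / D"
      by (simp add: diff_divide_distrib)
    also have "\<dots> = (if r = i then 1 else 0) - (if r = k then p i / p k else 0)"
      using r[of r] ij False k i by auto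
    finally show ?thesis .
  qed
  then show ?thesis by blast
qed

lemma value_at_linear: "value_at p (\<Sum>i\<in>UNIV. const (c i) * coord i) = (\<Sum>i\<in>UNIV. c i * p i)"
  by (simp add: value_at.evaluate_sum value_at.evaluate_mult)

lemma coordinate_decomposition:
  assumes l: "projection_from p l" and pk: "p k \<noteq> 0"
  shows "\<exists>g. binary_form l 1 g \<and> coord i = const (p i) * (const (1 / p k) * coord k) + g"
proof -
  have l1: "homogeneous 1 (l j)" "value_at p (l j) = 0" for j
    using l by (auto simp: projection_from_def)
  obtain a where a: "l 0 = (\<Sum>i\<in>UNIV. const (a i) * coord i)"
    using linear_form[OF l1(1)] .
  obtain b where b: "l 1 = (\<Sum>i\<in>UNIV. const (b i) * coord i)"
    using linear_form[OF l1(1)] .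
  note ab = a b
  have comb: "const s * l 0 + const t * l 1 = (\<Sum>r\<in>UNIV. const (s * a r + t * b r) * coord r)" for s t
    by (simp add: ab sum_distrib_left const_add const_mult distrib_right sum.distrib mult.assoc)
  have "\<exists>s t. \<forall>r. s * a r + t * b r = (if r = i then 1 else 0) - (if r = k then p i / p k else 0)"
  proof (rule vanishing_linear_forms_span)
    fix s t assume "\<forall>r. s * a r + t * b r = 0"
    then have "const s * l 0 + const t * l 1 = 0"
      by (simp add: comb)
    then show "s = 0 \<and> t = 0"
      using l unfolding projection_from_def by blast
  qed (use pk l1(2)[of 0] l1(2)[of 1] in \<open>simp_all add: ab value_at_linear\<close>)
  then obtain s t where st: "\<And>r. s * a r + t * b r = (if r = i then 1 else 0) - (if r = k then p i / p k else 0)"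
    by blast
  have "const s * l 0 + const t * l 1
    = (\<Sum>r\<in>UNIV. (if r = i then coord r else 0) - (if r = k then const (p i / p k) * coord r else 0))"
    unfolding comb st by (intro sum.cong) (auto simp: const_add const_uminus left_diff_distrib const_mult
        diff_conv_add_uminus distrib_right simp del: add_uminus_conv_diff)
  also have "\<dots> = coord i - const (p i / p k) * coord k"
    by (simp add: sum_subtractf)
  also have "const (p i / p k) = const (p i) * (const (1 / p k) :: (3, 'a) mpoly)"
    by (simp flip: const_mult)
  finally have "coord i = const (p i) * (const (1 / p k) * coord k) + (const s * l 0 + const t * l 1)"
    by (simp add: mult.assoc)
  moreover have "binary_form l (0 + 1) (const s * l 0 + const t * l 1)"
    by (intro binary_form_add binary_form_mult binary_form_const binary_form_l)
  ultimately show ?thesis by auto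
qed

text \<open>A form of positive degree dividing both \<open>l 0\<close> and \<open>l 1\<close> would
  make them scalar multiples of itself, hence dependent. A constant is zero or a unit and so not
  irreducible.\<close>

lemma projection_not_dvd:
  assumes l: "projection_from p l" and F: "irreducible_curve F"
  shows "\<exists>j. \<not> F dvd l j"
proof (rule ccontr)
  assume "\<not> (\<exists>j. \<not> F dvd l j)"
  then have dvd: "F dvd l 0" "F dvd l 1" by auto
  have l1: "homogeneous 1 (l j)" for j
    using l by (auto simp: projection_from_def)
  obtain d where d: "homogeneous d F" and irred: "Factorial_Ring.irreducible F"
    using F by (auto simp: irreducible_curve_def)
  have "d > 0"
  proof (rule ccontr)
    assume "\<not> d > 0"
    then obtain c where c: "F = const c"
      using d homogeneous_0_obtains by blast
    then have "c \<noteq> 0"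
      using irred by (auto simp: irreducible_def)
    then have "1 = F * const (1 / c)"
      by (simp add: c flip: const_mult)
    then show False
      using irred by (metis dvd_triv_left irreducible_def)
  qed
  obtain a where a: "l 0 = const a * F"
    using linear_multiple_of_form[OF l1 d \<open>d > 0\<close> dvd(1)] .
  obtain b where b: "l 1 = const b * F"
    using linear_multiple_of_form[OF l1 d \<open>d > 0\<close> dvd(2)] .
  note ab = a b
  then have "const b * l 0 + const (- a) * l 1 = 0"
    by (simp add: const_uminus)
  then have "a = 0"
    using l unfolding projection_from_def by (metis neg_equal_0_iff_equal)
  then have "const 1 * l 0 + const 0 * l 1 = 0"
    by (simp add: ab)
  then have "(1::'a) = 0"
    using l unfolding projection_from_def by blast
  then show False by simp
qed

theorem theorem1:
  fixes p :: "3 \<Rightarrow> 'k::alg_closed_field"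
    and l :: "2 \<Rightarrow> (3, 'k) mpoly"
    and F :: "(3, 'k) mpoly"
  assumes "\<exists>i. p i \<noteq> 0"
    and "projection_from p l"
    and "irreducible_curve F"
    and "galois_extension (function_field F) (pencil_field F l)"
    and "\<exists>n\<le>3. has_degree (function_field F) (pencil_field F l) n"
  shows "extends_to_subgroup F l (Jonq l)"
proof -
  obtain k where k: "p k \<noteq> 0"
    using assms(1) by blast
  obtain j where j: "\<not> F dvd l j"
    using projection_not_dvd[OF assms(2,3)] by blast
  obtain n where n: "n \<le> 3" "has_degree (function_field F) (pencil_field F l) n"
    using assms(5) by blast
  have field: "field (function_field F)" and subfield: "subfield (pencil_field F l) (function_field F)"
    using assms(4) by (simp_all add: galois_extension_def)
  interpret L: field "function_field F" by (rule field)
  have l1: "homogeneous 1 (l i)" "value_at p (l i) = 0" for i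
    using assms(2) by (auto simp: projection_from_def)
  \<comment> \<open>The form \<open>x_k / p_k\<close> has value 1 at \<open>p\<close>, and
    \<open>l j\<close> is a line through \<open>p\<close> that does not contain the curve.\<close>
  interpret point_projection F l p "const (1 / p k) * coord k" "l j"
  proof
    show "\<exists>d. homogeneous d F"
      using assms(3) by (simp add: irreducible_curve_def)
    show "F dvd A \<or> F dvd B" if "homogeneous a A" "homogeneous b B" "F dvd A * B" for a A b B
      using function_field_prime[OF L.monoid_axioms that] .
    \<comment> \<open>Otherwise \<open>F\<close> would divide the linear form
      \<open>l j\<close>.\<close>
    show "\<exists>i. \<not> F dvd coord i"
      using linear_form_dvd_subst[OF l1(1)[of j], of F coord] j by auto
    show "homogeneous 1 (const (1 / p k) * coord k :: (3, 'k) mpoly)"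
      using homogeneous_mult[OF homogeneous_const homogeneous_coord] by simp
    show "value_at p (const (1 / p k) * coord k) = 1"
      using k by (simp add: value_at.evaluate_mult)
    show "\<exists>g. binary_form l 1 g \<and> coord i = const (p i) * (const (1 / p k) * coord k) + g" for i
      by (rule coordinate_decomposition[OF assms(2) k])
  qed (use field l1 j in auto)
  show ?thesis
    using extends n subfield by (simp add: has_degree_def)
qed

end
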